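(* Let $\mu$ be a finite Borel measure on $(-\pi,\pi)$ and $\mu^\#$ its symmetrization, and let $u_\mu,u_{\mu^\#}$ be the solutions of the Dirichlet problem $-u''=\mu$ (distributions on $(-\pi,\pi)$), $u(\pm\pi)=0$. Then $\|u_\mu\|_{L^p}\le\|u_{\mu^\#}\|_{L^p}$ for all $1\le p\le\infty$. Moreover, equality holds if and only if the Radon–Nikodym derivative $f$ of $\mu$ equals $f^\#$ a.e. on $(-\pi,\pi)$ and the singular part of $\mu$ is a (nonnegative multiple of a) Dirac mass at the origin, i.e. $\mu=\mu^\#$.
   Context: A "Borel measure on $(-\pi,\pi)$" means a positive, non-zero measure on the Borel sets of $(-\pi,\pi)$; $\lambda$ is Lebesgue measure; $L^p$ norms are on $[-\pi,\pi]$. $G(x,y)=-\frac{xy}{2\pi}-\frac12|x-y|+\frac{\pi}{2}$ and $u_\mu(x)=\int G(x,y)\,d\mu(y)$. Decomposition $\mu=\nu+\sigma+\delta$ with $d\nu=f\,d\lambda$, $0\le f\in L^1$, $\sigma\perp\lambda$ atomless, $\delta$ purely discontinuous; singular part $\sigma+\delta$. $f^\#(t)=f^*(2|t|)$ with $f^*(t)=\inf\{s:\lambda(\{f>s\})\le t\}$ ($t\in(0,2\pi)$). Symmetrization: $d\mu^\#=f^\#\,d\lambda+M\,d\delta_0$, $M=\sigma((-\pi,\pi))+\delta((-\pi,\pi))$. *)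

theory Defs
  imports "HOL-Analysis.Analysis" "HOL-Probability.Essential_Supremum"
begin

text \<open>Green function of the Dirichlet problem on (-pi,pi).\<close>
definition green :: "real \<Rightarrow> real \<Rightarrow> real" where
  "green x y = - (x * y) / (2 * pi) - \<bar>x - y\<bar> / 2 + pi / 2"

definition u_meas :: "real measure \<Rightarrow> real \<Rightarrow> real" where
  "u_meas M x = (\<integral>y. green x y \<partial>M)"

definition decr_rearr :: "(real \<Rightarrow> real) \<Rightarrow> real \<Rightarrow> real" where
  "decr_rearr f t = Inf {s. emeasure lborel {x \<in> {-pi<..<pi}. f x > s} \<le> ennreal t}"

definition symm_rearr :: "(real \<Rightarrow> real) \<Rightarrow> real \<Rightarrow> real" where
  "symm_rearr f t = decr_rearr f (2 * \<bar>t\<bar>)"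

text \<open>Symmetrization: d mu# = f# d lambda (on (-pi,pi)) + m d delta_0, m the total singular mass.\<close>
definition symmetrization :: "(real \<Rightarrow> real) \<Rightarrow> ennreal \<Rightarrow> real measure" where
  "symmetrization f m = measure_of UNIV (sets borel)
     (\<lambda>A. (\<integral>\<^sup>+x. ennreal (symm_rearr f x) * indicator ({-pi<..<pi} \<inter> A) x \<partial>lborel)
          + m * indicator A 0)"

definition Lp_norm :: "ereal \<Rightarrow> (real \<Rightarrow> real) \<Rightarrow> ereal" where
  "Lp_norm p u = (if p = \<infinity> then esssup (restrict_space lborel {-pi..pi}) (\<lambda>x. ereal \<bar>u x\<bar>)
     else ereal ((\<integral>x. \<bar>u x\<bar> powr (real_of_ereal p) \<partial>(restrict_space lborel {-pi..pi}))
                  powr (1 / real_of_ereal p)))"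

end

theory Submission
  imports Defs
begin

text \<open>
  For \<open>-pi < c \<le> d < pi\<close> and \<open>r = (d - c) / 2\<close>, a suitable convex combination of the Green functions
  with poles \<open>c\<close> and \<open>d\<close> is a multiple, by a factor at most 1, of a trapezoidal \<open>tent\<close> with
  plateau on \<open>[c, d]\<close>. Its superlevel sets are intervals whose lengths depend on \<open>d - c\<close> only, and
  an interval has at most the symmetrized mass of the centred interval of the same length. By the
  layer-cake formula, the values of the potential \<open>u\<close> of the measure at \<open>c\<close> and \<open>d\<close> cannot both exceed
  the value at \<open>r\<close> of the potential \<open>v\<close> of the symmetrization. Taking for \<open>c\<close> and \<open>d\<close> the extreme points of a
  superlevel set of \<open>u\<close> shows that it is at most as large as that of \<open>v\<close>, which bounds all \<open>L\<^sup>p\<close> norms.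

  If the norms agree for some \<open>p\<close>, the maxima of \<open>u\<close> and \<open>v\<close> agree. The case \<open>c = d = x\<close> gives
  \<open>u x \<le> (1 - x\<^sup>2 / pi\<^sup>2) * v 0\<close>, so \<open>u\<close> attains its maximum at 0, and then all centred intervals have the
  same mass for both measures. Letting them shrink puts the whole singular part at 0, and comparing the
  density on \<open>{f > s}\<close> with the density on the centred interval of the same length shows that these
  sets agree up to a null set.
\<close>

section \<open>Layer cakes and essential suprema\<close>

text \<open>\<open>ennreal (g x)\<close> is the length of the interval from 0 to \<open>g x\<close>,
  which is empty for negative \<open>g x\<close>; the rest is Tonelli. The strict form serves tents
  and densities, the weak form powers of potentials, whose superlevel sets at positive levels are
  compact.\<close>

lemma nn_integral_layer_cake:
  fixes g :: "'a \<Rightarrow> real"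
  assumes "sigma_finite_measure M" and g[measurable]: "g \<in> borel_measurable M"
  shows "(\<integral>\<^sup>+x. ennreal (g x) \<partial>M) =
      (\<integral>\<^sup>+s. indicator {0<..} s * emeasure M {x \<in> space M. s < g x} \<partial>lborel)" (is ?strict)
    and "(\<integral>\<^sup>+x. ennreal (g x) \<partial>M) =
      (\<integral>\<^sup>+s. indicator {0<..} s * emeasure M {x \<in> space M. s \<le> g x} \<partial>lborel)" (is ?weak)
proof -
  interpret pair_sigma_finite M "lborel :: real measure"
    using assms(1) by (simp add: pair_sigma_finite_def lborel.sigma_finite_measure_axioms)
  have "(\<integral>\<^sup>+x. ennreal (g x) \<partial>M)
      = (\<integral>\<^sup>+x. (\<integral>\<^sup>+s. indicator {0<..} s * indicator {x \<in> space M. s < g x} x \<partial>lborel) \<partial>M)"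
  proof (rule nn_integral_cong)
    fix x assume "x \<in> space M"
    then have "(\<integral>\<^sup>+s. indicator {0<..} s * indicator {x \<in> space M. s < g x} x \<partial>lborel)
        = (\<integral>\<^sup>+s. indicator {0<..<g x} s \<partial>lborel)"
      by (intro nn_integral_cong) (auto split: split_indicator)
    then show "ennreal (g x) = (\<integral>\<^sup>+s. indicator {0<..} s * indicator {x \<in> space M. s < g x} x \<partial>lborel)"
      by (cases "0 \<le> g x") (auto simp: ennreal_neg)
  qed
  also have "\<dots> = (\<integral>\<^sup>+s. (\<integral>\<^sup>+x. indicator {0<..} s * indicator {x \<in> space M. s < g x} x \<partial>M) \<partial>lborel)"
    by (rule Fubini'[symmetric]) simp
  finally show ?strict
    by (simp add: nn_integral_cmult)
  have "(\<integral>\<^sup>+x. ennreal (g x) \<partial>M)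
      = (\<integral>\<^sup>+x. (\<integral>\<^sup>+s. indicator {0<..} s * indicator {x \<in> space M. s \<le> g x} x \<partial>lborel) \<partial>M)"
  proof (rule nn_integral_cong)
    fix x assume "x \<in> space M"
    then have "(\<integral>\<^sup>+s. indicator {0<..} s * indicator {x \<in> space M. s \<le> g x} x \<partial>lborel)
        = (\<integral>\<^sup>+s. indicator {0<..g x} s \<partial>lborel)"
      by (intro nn_integral_cong) (auto split: split_indicator)
    then show "ennreal (g x) = (\<integral>\<^sup>+s. indicator {0<..} s * indicator {x \<in> space M. s \<le> g x} x \<partial>lborel)"
      by (cases "0 \<le> g x") (auto simp: ennreal_neg)
  qed
  also have "\<dots> = (\<integral>\<^sup>+s. (\<integral>\<^sup>+x. indicator {0<..} s * indicator {x \<in> space M. s \<le> g x} x \<partial>M) \<partial>lborel)"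
    by (rule Fubini'[symmetric]) simp
  finally show ?weak
    by (simp add: nn_integral_cmult)
qed

lemma borel_measurable_superlevel:
  fixes g :: "'a \<Rightarrow> real"
  assumes "sigma_finite_measure M" and [measurable]: "g \<in> borel_measurable M"
  shows "(\<lambda>s. emeasure M {x \<in> space M. s < g x}) \<in> borel_measurable lborel"
proof -
  interpret sigma_finite_measure M by fact
  show ?thesis
    by measurable
qed

text \<open>The tool for the equality cases: ordered integrands with the same finite integral agree
  almost everywhere. Finiteness permits the subtraction in \<open>ennreal\<close>.\<close>

lemma nn_integral_eq_imp_AE_eq:
  assumes [measurable]: "f \<in> borel_measurable M" "g \<in> borel_measurable M"
    and le: "\<And>x. f x \<le> g x"
    and eq: "(\<integral>\<^sup>+x. f x \<partial>M) = (\<integral>\<^sup>+x. g x \<partial>M)" and fin: "(\<integral>\<^sup>+x. f x \<partial>M) \<noteq> \<infinity>"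
  shows "AE x in M. f x = g x"
proof -
  have "(\<integral>\<^sup>+x. g x - f x \<partial>M) = (\<integral>\<^sup>+x. g x \<partial>M) - (\<integral>\<^sup>+x. f x \<partial>M)"
    using le fin by (intro nn_integral_diff) auto
  then have "(\<integral>\<^sup>+x. g x - f x \<partial>M) = 0"
    using eq fin by (simp add: less_top ennreal_minus_eq_0)
  then have "AE x in M. g x - f x = 0"
    by (subst (asm) nn_integral_0_iff_AE) auto
  moreover have "AE x in M. f x \<noteq> \<infinity>"
    using fin by (intro nn_integral_PInf_AE) auto
  ultimately show ?thesis
  proof eventually_elim
    case (elim x)
    then have "g x \<le> f x"
      by (simp add: ennreal_minus_eq_0)
    with le[of x] show ?case by simp
  qed
qed

text \<open>Turns an a.e. statement into a witness inside a prescribed window, since nonempty open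
  intervals are not null.\<close>

lemma AE_lborel_imp_ex_in_interval:
  assumes "AE x in lborel. P x" "a < (b::real)"
  shows "\<exists>x\<in>{a<..<b}. P x"
proof (rule ccontr)
  assume "\<not> ?thesis"
  with assms(1) have "AE x in lborel. x \<notin> {a<..<b}"
    by auto
  then have "emeasure lborel {a<..<b} = 0"
    by (subst (asm) AE_iff_measurable[of "{a<..<b}"]) auto
  then show False
    using assms(2) by simp
qed

lemma esssup_continuous_max:
  fixes u :: "real \<Rightarrow> real"
  assumes cont: "continuous_on {a..b} u" and "a < b" and x0: "x0 \<in> {a..b}"
    and max: "\<And>x. x \<in> {a..b} \<Longrightarrow> u x \<le> u x0"
  shows "esssup (restrict_space lborel {a..b}) (\<lambda>x. ereal (u x)) = ereal (u x0)"
proof (rule antisym)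
  let ?L = "restrict_space lborel {a..b}"
  have [measurable]: "u \<in> borel_measurable ?L"
    using borel_measurable_continuous_on_restrict[OF cont]
    by (simp add: measurable_def sets_restrict_space space_restrict_space)
  show "esssup ?L (\<lambda>x. ereal (u x)) \<le> ereal (u x0)"
    using max by (intro esssup_I) (auto simp: space_restrict_space intro!: AE_I2)
  show "ereal (u x0) \<le> esssup ?L (\<lambda>x. ereal (u x))"
  proof (rule ccontr)
    assume "\<not> ?thesis"
    then obtain z where z: "esssup ?L (\<lambda>x. ereal (u x)) < ereal z" "z < u x0"
      by (metis ereal_dense2 ereal_less(2) less_ereal.simps(1) linorder_not_le)
    have "\<exists>d>0. \<forall>x\<in>{a..b}. dist x x0 < d \<longrightarrow> dist (u x) (u x0) < u x0 - z"
      using cont x0 z(2) by (meson continuous_on_iff diff_gt_0_iff_gt)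
    then obtain d where d: "d > 0" "\<And>x. x \<in> {a..b} \<Longrightarrow> \<bar>x - x0\<bar> < d \<Longrightarrow> \<bar>u x - u x0\<bar> < u x0 - z"
      by (auto simp: dist_real_def)
    have "AE x in ?L. ereal (u x) \<le> esssup ?L (\<lambda>x. ereal (u x))"
      by (rule esssup_AE)
    then have "AE x in lborel. x \<in> {a..b} \<longrightarrow> ereal (u x) \<le> esssup ?L (\<lambda>x. ereal (u x))"
      by (subst (asm) AE_restrict_space_iff) auto
    \<comment> \<open>Cutting the window around \<open>x0\<close> down to \<open>[a, b]\<close>
      leaves it nonempty even when \<open>x0\<close> is an endpoint.\<close>
    from AE_lborel_imp_ex_in_interval[OF this, of "max a (x0 - d)" "min b (x0 + d)"]
    obtain x where "x \<in> {max a (x0 - d)<..<min b (x0 + d)}"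
      "x \<in> {a..b} \<longrightarrow> ereal (u x) \<le> esssup ?L (\<lambda>x. ereal (u x))"
      using d(1) x0 \<open>a < b\<close> by auto
    then have x: "x \<in> {a..b}" "\<bar>x - x0\<bar> < d" "ereal (u x) \<le> esssup ?L (\<lambda>x. ereal (u x))"
      by auto
    with d(2)[of x] z have "ereal z < ereal (u x)"
      by auto
    from less_le_trans[OF this x(3)] z(1) show False
      by simp
  qed
qed

section \<open>Potentials and their comparison\<close>

text \<open>For \<open>-pi < c \<le> d < pi\<close>, a trapezoid with zeros at \<open>-pi\<close>
  and \<open>pi\<close> and plateau on \<open>[c, d]\<close>. The height is normalized so that, on
  the interval, \<open>tent (-r) r\<close> is the mean of the Green functions with poles
  \<open>-r\<close> and \<open>r\<close>.\<close>

definition tent :: "real \<Rightarrow> real \<Rightarrow> real \<Rightarrow> real" where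
  "tent c d y = (pi - (d - c) / 2) / 2 * min 1 (min ((pi + y) / (pi + c)) ((pi - y) / (pi - d)))"

text \<open>The classical product form: a solution vanishing at \<open>-pi\<close> times one
  vanishing at \<open>pi\<close>, divided by the modulus \<open>2 * pi\<close> of their Wronskian.
  Sign and boundary values can be read off.\<close>

lemma green_eq:
  "green x y = (if x \<le> y then (pi + x) * (pi - y) else (pi + y) * (pi - x)) / (2 * pi)"
  by (auto simp: green_def field_simps)

lemma green_nonneg: "\<bar>x\<bar> \<le> pi \<Longrightarrow> \<bar>y\<bar> \<le> pi \<Longrightarrow> 0 \<le> green x y"
  unfolding green_eq by (auto intro!: divide_nonneg_pos mult_nonneg_nonneg)

text \<open>The bilinear term has slope at most 1/2 in the first argument because
  \<open>\<bar>y\<bar> \<le> pi\<close>, and the absolute value contributes another 1/2.\<close>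

lemma green_lipschitz:
  assumes "\<bar>y\<bar> \<le> pi" shows "\<bar>green x y - green x' y\<bar> \<le> \<bar>x - x'\<bar>"
proof -
  have "\<bar>(x' - x) * y / (2 * pi)\<bar> \<le> \<bar>x - x'\<bar> * pi / (2 * pi)"
    using mult_left_mono[OF assms, of "\<bar>x - x'\<bar>"]
    by (simp add: abs_mult abs_divide abs_minus_commute divide_right_mono pos_divide_le_eq)
  then have "\<bar>(x' - x) * y / (2 * pi)\<bar> \<le> \<bar>x - x'\<bar> / 2"
    by simp
  moreover have "green x y - green x' y = (x' - x) * y / (2 * pi) + (\<bar>x' - y\<bar> - \<bar>x - y\<bar>) / 2"
    by (simp add: green_def field_simps)
  moreover have "\<bar>A + (\<bar>x' - y\<bar> - \<bar>x - y\<bar>) / 2\<bar> \<le> \<bar>x - x'\<bar>" if "\<bar>A\<bar> \<le> \<bar>x - x'\<bar> / 2" for A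
    using that by (auto simp: abs_if field_simps split: if_splits)
  ultimately show ?thesis
    by (simp only:)
qed

text \<open>On \<open>[c, d]\<close> the slopes of \<open>green c\<close> and \<open>green d\<close>
  are \<open>- (pi + c) / (2 * pi)\<close> and \<open>(pi - d) / (2 * pi)\<close>. The weights are
  proportional to \<open>pi - d\<close> and \<open>pi + c\<close> so that these slopes cancel and a
  plateau appears.\<close>

lemma green_combination_eq_tent:
  assumes "-pi < c" "c \<le> d" "d < pi" "\<bar>y\<bar> \<le> pi"
  shows "(pi - d) / (2 * pi - d + c) * green c y + (pi + c) / (2 * pi - d + c) * green d y
    = (pi - d) * (pi + c) / (pi - (d - c) / 2)\<^sup>2 * tent c d y"
proof -
  define D where "D = 2 * pi - d + c"
  have D: "D > 0" "pi - (d - c) / 2 = D / 2" "pi + c > 0" "pi - d > 0"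
    using assms by (auto simp: D_def diff_divide_distrib)
  define m where "m = min 1 (min ((pi + y) / (pi + c)) ((pi - y) / (pi - d)))"
  have R: "(pi - d) * (pi + c) / (pi - (d - c) / 2)\<^sup>2 * tent c d y = (pi - d) * (pi + c) / D * m"
    unfolding tent_def D(2) m_def[symmetric] using D(1) by (simp add: field_simps power2_eq_square)
  consider "y \<le> c" | "c < y" "y \<le> d" | "d < y" by linarith
  then have L: "(pi - d) * green c y + (pi + c) * green d y = (pi - d) * (pi + c) * m"
  proof cases
    case 1
    have "(pi + y) / (pi + c) \<le> 1" "1 \<le> (pi - y) / (pi - d)"
      using 1 assms D by (auto simp: field_simps)
    then have m: "m = (pi + y) / (pi + c)" unfolding m_def by auto
    have "green c y = (pi + y) * (pi - c) / (2 * pi)" "green d y = (pi + y) * (pi - d) / (2 * pi)"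
      using 1 assms by (cases "d = y"; cases "c = y"; auto simp: green_eq)+
    then have "(pi - d) * green c y + (pi + c) * green d y
        = (pi + y) * (pi - d) * (pi - c + pi + c) / (2 * pi)"
      by (simp only: times_divide_eq_right add_divide_distrib[symmetric]) (simp add: algebra_simps)
    then show ?thesis unfolding m using D by simp
  next
    case 2
    have "1 \<le> (pi + y) / (pi + c)" "1 \<le> (pi - y) / (pi - d)"
      using 2 assms D by (auto simp: field_simps)
    then have m: "m = 1" unfolding m_def by auto
    have "green c y = (pi + c) * (pi - y) / (2 * pi)" "green d y = (pi + y) * (pi - d) / (2 * pi)"
      using 2 assms by (cases "d = y"; auto simp: green_eq)+
    then have "(pi - d) * green c y + (pi + c) * green d y
        = (pi + c) * (pi - d) * (pi - y + pi + y) / (2 * pi)"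
      by (simp only: times_divide_eq_right add_divide_distrib[symmetric]) (simp add: algebra_simps)
    then show ?thesis unfolding m using D by simp
  next
    case 3
    have "1 \<le> (pi + y) / (pi + c)" "(pi - y) / (pi - d) \<le> 1"
      using 3 assms D by (auto simp: field_simps)
    then have m: "m = (pi - y) / (pi - d)" unfolding m_def by auto
    have "green c y = (pi + c) * (pi - y) / (2 * pi)" "green d y = (pi + d) * (pi - y) / (2 * pi)"
      using 3 assms by (auto simp: green_eq)
    then have "(pi - d) * green c y + (pi + c) * green d y
        = (pi + c) * (pi - y) * (pi - d + pi + d) / (2 * pi)"
      by (simp only: times_divide_eq_right add_divide_distrib[symmetric]) (simp add: algebra_simps)
    then show ?thesis unfolding m using D by simp
  qed
  show ?thesis
    unfolding R D_def[symmetric] using L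
    by (simp only: times_divide_eq_left add_divide_distrib[symmetric])
qed

text \<open>The endpoints solve \<open>tent c d y = s\<close> on the two sloping sides. Since
  \<open>(pi + c) + (pi - d) = 2 * (pi - r)\<close>, their distance is
  \<open>2 * (pi - 2 * s)\<close>; only the cutoff level still depends on \<open>r\<close>.\<close>

lemma tent_superlevel:
  assumes "-pi < c" "c \<le> d" "d < pi" "0 < s"
  defines "r \<equiv> (d - c) / 2"
  shows "{y. s < tent c d y} = (if s < (pi - r) / 2
    then {-pi + 2 * s * (pi + c) / (pi - r) <..< pi - 2 * s * (pi - d) / (pi - r)} else {})"
proof -
  have pos: "pi - r > 0" "pi + c > 0" "pi - d > 0"
    using assms by (auto simp: field_simps)
  define t where "t = 2 * s / (pi - r)"
  have t: "s = (pi - r) / 2 * t" "t < 1 \<longleftrightarrow> s < (pi - r) / 2"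
    using pos by (auto simp: t_def field_simps)
  have "s < tent c d y \<longleftrightarrow> t < min 1 (min ((pi + y) / (pi + c)) ((pi - y) / (pi - d)))" for y
    unfolding t(1) tent_def r_def[symmetric] using pos(1) by (simp add: mult_less_cancel_left_pos)
  then have iff: "s < tent c d y \<longleftrightarrow> s < (pi - r) / 2 \<and> t * (pi + c) < pi + y \<and> t * (pi - d) < pi - y" for y
    by (simp only: min_less_iff_conj t(2) pos_less_divide_eq[OF pos(2)] pos_less_divide_eq[OF pos(3)])
  have "t * (pi + c) = 2 * s * (pi + c) / (pi - r)" "t * (pi - d) = 2 * s * (pi - d) / (pi - r)"
    by (simp_all add: t_def)
  then show ?thesis
    unfolding set_eq_iff mem_Collect_eq iff by (simp only:) (simp, linarith)
qed

lemma tent_nonneg: "-pi < c \<Longrightarrow> c \<le> d \<Longrightarrow> d < pi \<Longrightarrow> \<bar>y\<bar> \<le> pi \<Longrightarrow> 0 \<le> tent c d y"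
  unfolding tent_def by (intro mult_nonneg_nonneg) auto

lemma tent_le:
  assumes "-pi < c" "c \<le> d" "d < pi" shows "tent c d y \<le> pi / 2"
proof -
  have "tent c d y \<le> (pi - (d - c) / 2) / 2 * 1"
    unfolding tent_def using assms by (intro mult_left_mono) auto
  also have "\<dots> \<le> pi / 2"
    using assms by simp
  finally show ?thesis .
qed

lemma tent_symmetric:
  assumes "0 \<le> r" "r < pi" shows "tent (-r) r y = min (pi - r) (pi - \<bar>y\<bar>) / 2"
proof -
  have "min ((pi + y) / (pi - r)) ((pi - y) / (pi - r)) = (pi - \<bar>y\<bar>) / (pi - r)"
    using assms by (auto simp: min_def divide_le_cancel)
  then have "tent (-r) r y = (pi - r) * min 1 ((pi - \<bar>y\<bar>) / (pi - r)) / 2"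
    by (simp add: tent_def)
  also have "(pi - r) * min 1 ((pi - \<bar>y\<bar>) / (pi - r)) = min (pi - r) (pi - \<bar>y\<bar>)"
    using assms by (simp add: min_mult_distrib_left)
  finally show ?thesis .
qed

lemma tent_measurable[measurable]: "tent c d \<in> borel_measurable borel"
  unfolding tent_def by measurable

lemma green_measurable[measurable]: "green x \<in> borel_measurable borel"
  unfolding green_def by measurable

section \<open>Potentials of finite measures carried by the interval\<close>

locale finite_measure_on_interval = finite_measure M for M :: "real measure" +
  assumes sets_eq[measurable_cong]: "sets M = sets borel"
    and supp: "emeasure M (UNIV - {-pi<..<pi}) = 0"
begin

lemma space_eq[simp]: "space M = UNIV"
  using sets_eq_imp_space_eq[OF sets_eq] by simp

lemma AE_interval: "AE y in M. -pi < y \<and> y < pi"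
  using supp by (intro AE_I[of _ _ "UNIV - {-pi<..<pi}"]) auto

lemma integrable_green: "integrable M (green x)"
proof (rule integrable_const_bound[where B = "\<bar>x\<bar> + pi"])
  show "AE y in M. norm (green x y) \<le> \<bar>x\<bar> + pi"
    using AE_interval
  proof eventually_elim
    case (elim y)
    then have "\<bar>green x y - green 0 y\<bar> \<le> \<bar>x\<bar>" "\<bar>green 0 y\<bar> \<le> pi"
      using green_lipschitz[of y x 0] by (auto simp: green_def)
    then show ?case by simp
  qed
qed measurable

lemma integrable_tent: "-pi < c \<Longrightarrow> c \<le> d \<Longrightarrow> d < pi \<Longrightarrow> integrable M (tent c d)"
  using AE_interval tent_nonneg[of c d] tent_le[of c d]
  by (intro integrable_const_bound[where B = "pi / 2"]) auto

lemma u_lipschitz: "\<bar>u_meas M x - u_meas M x'\<bar> \<le> measure M UNIV * \<bar>x - x'\<bar>"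
proof -
  have "\<bar>\<integral>y. green x y - green x' y \<partial>M\<bar> \<le> (\<integral>y. \<bar>green x y - green x' y\<bar> \<partial>M)"
    by (rule integral_abs_bound)
  also have "\<dots> \<le> (\<integral>y. \<bar>x - x'\<bar> \<partial>M)"
    using AE_interval by (intro integral_mono_AE) (auto intro!: integrable_green green_lipschitz)
  finally show ?thesis
    by (simp add: u_meas_def integrable_green)
qed

lemma continuous_u: "continuous_on A (u_meas M)"
proof (rule lipschitz_on_continuous_on)
  show "(measure M UNIV)-lipschitz_on A (u_meas M)"
    using u_lipschitz by (intro lipschitz_onI) (auto simp: dist_real_def)
qed

lemma u_nonneg: "\<bar>x\<bar> \<le> pi \<Longrightarrow> 0 \<le> u_meas M x"
  unfolding u_meas_def using AE_interval
  by (intro integral_nonneg_AE) (auto intro!: green_nonneg)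

lemma u_boundary: "u_meas M pi = 0" "u_meas M (-pi) = 0"
  unfolding u_meas_def using AE_interval
  by (auto intro!: integral_eq_zero_AE simp: green_eq)

lemma u_combination_eq_tent:
  assumes "-pi < c" "c \<le> d" "d < pi"
  shows "(pi - d) / (2 * pi - d + c) * u_meas M c + (pi + c) / (2 * pi - d + c) * u_meas M d
    = (pi - d) * (pi + c) / (pi - (d - c) / 2)\<^sup>2 * (\<integral>y. tent c d y \<partial>M)"
proof -
  have "(pi - d) / (2 * pi - d + c) * u_meas M c + (pi + c) / (2 * pi - d + c) * u_meas M d
    = (\<integral>y. (pi - d) / (2 * pi - d + c) * green c y + (pi + c) / (2 * pi - d + c) * green d y \<partial>M)"
    unfolding u_meas_def by (simp add: integrable_green)
  also have "\<dots> = (\<integral>y. (pi - d) * (pi + c) / (pi - (d - c) / 2)\<^sup>2 * tent c d y \<partial>M)"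
    using AE_interval green_combination_eq_tent[OF assms]
    by (intro integral_cong_AE) auto
  finally show ?thesis
    by simp
qed

text \<open>\<open>green 0\<close> is strictly positive inside the interval, so a vanishing integral
  would leave no mass there.\<close>

lemma u_pos:
  assumes "emeasure M UNIV \<noteq> 0" shows "0 < u_meas M 0"
proof (rule ccontr)
  assume "\<not> ?thesis"
  then have "(\<integral>y. green 0 y \<partial>M) = 0"
    using u_nonneg[of 0] by (simp add: u_meas_def)
  then have "AE y in M. green 0 y = 0"
    using AE_interval by (subst (asm) integral_nonneg_eq_0_iff_AE) (auto intro!: green_nonneg integrable_green)
  then have "AE y in M. False"
    using AE_interval by eventually_elim (auto simp: green_eq split: if_splits)
  then show False
    using assms by (simp add: AE_iff_measurable[OF _ refl])
qed

lemma nn_integral_tent: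
  assumes "-pi < c" "c \<le> d" "d < pi"
  shows "ennreal (\<integral>y. tent c d y \<partial>M) = (\<integral>\<^sup>+y. ennreal (tent c d y) \<partial>M)"
  using AE_interval assms
  by (intro nn_integral_eq_integral[symmetric] integrable_tent) (auto intro!: tent_nonneg)

end

section \<open>Comparison of potentials under domination by an even measure on centred
  intervals\<close>

locale radial_domination = M: finite_measure_on_interval M + N: finite_measure_on_interval N
  for M N :: "real measure" +
  assumes N_even: "distr N borel uminus = N"
    and dominated: "-pi \<le> a \<Longrightarrow> a < b \<Longrightarrow> b \<le> pi \<Longrightarrow>
      emeasure M {a<..<b} \<le> emeasure N {- ((b - a) / 2)<..<(b - a) / 2}"
begin

lemma v_even: "u_meas N (-x) = u_meas N x"
proof -
  have "u_meas N (-x) = (\<integral>y. green (-x) y \<partial>distr N borel uminus)"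
    by (simp add: u_meas_def N_even)
  also have "\<dots> = (\<integral>y. green (-x) (-y) \<partial>N)"
    by (rule integral_distr) auto
  also have "(\<lambda>y. green (-x) (-y)) = green x"
    by (auto simp: green_def abs_if)
  finally show ?thesis by (simp add: u_meas_def)
qed

text \<open>For poles \<open>-r\<close> and \<open>r\<close> the factor in front of the tent is 1,
  and evenness makes the two values of the potential coincide. So nothing is lost in the symmetric
  case.\<close>

lemma v_eq_tent:
  assumes "0 \<le> r" "r < pi" shows "u_meas N r = (\<integral>y. tent (-r) r y \<partial>N)"
proof -
  have "(pi - r) / (2 * pi - r + -r) = 1 / 2" "(pi + -r) / (2 * pi - r + -r) = 1 / 2"
    "(pi - r) * (pi + -r) / (pi - (r - -r) / 2)\<^sup>2 = 1"
    using assms by (simp_all add: power2_eq_square divide_eq_eq)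
  then have "1 / 2 * u_meas N (-r) + 1 / 2 * u_meas N r = 1 * (\<integral>y. tent (-r) r y \<partial>N)"
    using N.u_combination_eq_tent[of "-r" r] assms by (simp only:)
  then show ?thesis
    by (simp add: v_even)
qed

text \<open>By \<open>tent_symmetric\<close>, the symmetric tents decrease pointwise as the plateau
  widens.\<close>

lemma v_antimono:
  assumes "\<bar>x\<bar> \<le> r" "r < pi" shows "u_meas N r \<le> u_meas N x"
proof -
  have "u_meas N r = (\<integral>y. tent (-r) r y \<partial>N)"
    using assms by (intro v_eq_tent) auto
  also have "\<dots> \<le> (\<integral>y. tent (-\<bar>x\<bar>) \<bar>x\<bar> y \<partial>N)"
    using assms by (intro integral_mono N.integrable_tent) (auto simp: tent_symmetric)
  also have "\<dots> = u_meas N \<bar>x\<bar>"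
    using assms by (intro v_eq_tent[symmetric]) auto
  also have "\<dots> = u_meas N x"
    by (auto simp: abs_if v_even)
  finally show ?thesis .
qed

text \<open>Here \<open>dominated\<close> meets the tents: the two sets are open intervals of the
  same length, the second one centred, or both are empty.\<close>

lemma tent_superlevel_le:
  assumes "-pi < c" "c \<le> d" "d < pi" "0 < s"
  shows "emeasure M {y. s < tent c d y} \<le> emeasure N {y. s < tent (- ((d - c) / 2)) ((d - c) / 2) y}"
proof (cases "s < (pi - (d - c) / 2) / 2")
  case True
  define r where "r = (d - c) / 2"
  define a b where "a = -pi + 2 * s * (pi + c) / (pi - r)" and "b = pi - 2 * s * (pi - d) / (pi - r)"
  have r: "0 \<le> r" "r < pi" "s < (pi - r) / 2"
    using assms True by (auto simp: r_def)
  have "2 * s * (pi + c) / (pi - r) + 2 * s * (pi - d) / (pi - r) = 2 * s * (2 * (pi - r)) / (pi - r)"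
    unfolding add_divide_distrib[symmetric] distrib_left[symmetric] by (simp add: r_def diff_divide_distrib)
  also have "\<dots> = 4 * s"
    using r by (simp del: right_diff_distrib_numeral)
  finally have ab: "b - a = 2 * (pi - 2 * s)"
    by (simp add: a_def b_def)
  have "0 < b - a"
    unfolding ab using r by simp
  then have ab_bounds: "a < b" "-pi \<le> a" "b \<le> pi"
    using assms r by (simp, simp_all add: a_def b_def)
  have "{y. s < tent (-r) r y} = {- ((b - a) / 2)<..<(b - a) / 2}"
    using tent_superlevel[of "-r" r s] assms r by (simp add: ab diff_divide_distrib)
  moreover have "{y. s < tent c d y} = {a<..<b}"
    using tent_superlevel[of c d s] assms r by (simp add: a_def b_def r_def)
  ultimately show ?thesis
    using dominated[OF ab_bounds(2,1,3)] by (simp add: r_def)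
next
  case False
  then show ?thesis
    using tent_superlevel[OF assms] by simp
qed

lemma integral_tent_le:
  assumes "-pi < c" "c \<le> d" "d < pi"
  shows "(\<integral>y. tent c d y \<partial>M) \<le> u_meas N ((d - c) / 2)"
proof -
  define r where "r = (d - c) / 2"
  have r: "0 \<le> r" "r < pi" using assms by (auto simp: r_def)
  have "ennreal (\<integral>y. tent c d y \<partial>M) = (\<integral>\<^sup>+s. indicator {0<..} s * emeasure M {y. s < tent c d y} \<partial>lborel)"
    using nn_integral_layer_cake(1)[OF M.sigma_finite_measure_axioms, of "tent c d"]
    by (simp add: M.nn_integral_tent assms)
  also have "\<dots> \<le> (\<integral>\<^sup>+s. indicator {0<..} s * emeasure N {y. s < tent (-r) r y} \<partial>lborel)"
    using tent_superlevel_le[OF assms]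
    by (intro nn_integral_mono) (auto simp: r_def split: split_indicator)
  also have "\<dots> = ennreal (\<integral>y. tent (-r) r y \<partial>N)"
    using nn_integral_layer_cake(1)[OF N.sigma_finite_measure_axioms, of "tent (-r) r"] r
    by (simp add: N.nn_integral_tent)
  also have "\<dots> = ennreal (u_meas N r)"
    using r by (simp add: v_eq_tent)
  finally show ?thesis
    using N.u_nonneg[of r] r by (simp add: r_def)
qed

text \<open>The weights of the two poles sum to 1, so \<open>s\<close> is below the convex
  combination, which is a factor times a tent integral. The factor is at most 1 by the inequality of
  arithmetic and geometric means.\<close>

lemma talenti_comparison:
  assumes "-pi < c" "c \<le> d" "d < pi" "s \<le> u_meas M c" "s \<le> u_meas M d"
  shows "s \<le> u_meas N ((d - c) / 2)"
proof -
  define r where "r = (d - c) / 2"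
  have r: "0 \<le> r" "r < pi" using assms by (auto simp: r_def)
  have D: "0 < 2 * pi - d + c" using assms by simp
  have "s = (pi - d) / (2 * pi - d + c) * s + (pi + c) / (2 * pi - d + c) * s"
    using D by (simp add: add_divide_distrib[symmetric] distrib_right[symmetric] del: times_divide_eq_left)
  also have "\<dots> \<le> (pi - d) / (2 * pi - d + c) * u_meas M c + (pi + c) / (2 * pi - d + c) * u_meas M d"
    using assms D by (intro add_mono mult_left_mono) auto
  also have "\<dots> = (pi - d) * (pi + c) / (pi - r)\<^sup>2 * (\<integral>y. tent c d y \<partial>M)"
    using M.u_combination_eq_tent assms by (simp add: r_def)
  also have "\<dots> \<le> (pi - d) * (pi + c) / (pi - r)\<^sup>2 * u_meas N r"
    using integral_tent_le[of c d] assms by (intro mult_left_mono) (auto simp: r_def)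
  also have "\<dots> \<le> 1 * u_meas N r"
  proof (rule mult_right_mono)
    \<comment> \<open>\<open>pi - r\<close> is the arithmetic mean of \<open>pi - d\<close> and
      \<open>pi + c\<close>; the gap is the square of the midpoint of \<open>[c, d]\<close>.\<close>
    have "(pi - r)\<^sup>2 - (pi - d) * (pi + c) = ((c + d) / 2)\<^sup>2"
      by (simp add: r_def power2_eq_square field_simps)
    then have "(pi - d) * (pi + c) \<le> (pi - r)\<^sup>2"
      by (smt (verit) zero_le_power2)
    then show "(pi - d) * (pi + c) / (pi - r)\<^sup>2 \<le> 1"
      using r by (simp add: divide_le_eq_1)
    show "0 \<le> u_meas N r" using r by (intro N.u_nonneg) auto
  qed
  finally show ?thesis by (simp add: r_def)
qed

text \<open>With both poles at \<open>x\<close> the factor is kept instead of being bounded by 1. It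
  is below 1 away from the origin, which later locates the maximum.\<close>

lemma u_le_center:
  assumes "\<bar>x\<bar> \<le> pi" shows "u_meas M x \<le> (1 - x\<^sup>2 / pi\<^sup>2) * u_meas N 0"
proof (cases "\<bar>x\<bar> = pi")
  case True
  then have "x\<^sup>2 = pi\<^sup>2" by (metis power2_abs)
  moreover have "x = pi \<or> x = -pi"
    using True by linarith
  then have "u_meas M x = 0"
    using M.u_boundary by auto
  ultimately show ?thesis by simp
next
  case False
  with assms have x: "-pi < x" "x < pi" by auto
  have "u_meas M x = (pi - x) * (pi + x) / pi\<^sup>2 * (\<integral>y. tent x x y \<partial>M)"
    using M.u_combination_eq_tent[of x x] x by (simp add: distrib_right[symmetric] add_divide_distrib[symmetric] del: times_divide_eq_left)
  also have "\<dots> \<le> (pi - x) * (pi + x) / pi\<^sup>2 * u_meas N 0"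
    using integral_tent_le[of x x] x by (intro mult_left_mono) auto
  also have "(pi - x) * (pi + x) / pi\<^sup>2 = 1 - x\<^sup>2 / pi\<^sup>2"
    by (simp add: field_simps power2_eq_square)
  finally show ?thesis .
qed

text \<open>The superlevel set lies between its extreme points \<open>c\<close> and
  \<open>d\<close>. By \<open>talenti_comparison\<close> and monotonicity, the other potential is at
  least \<open>s\<close> on the centred interval of length \<open>d - c\<close>.\<close>

lemma superlevel_le:
  assumes "0 < s"
  shows "emeasure lborel {x \<in> {-pi..pi}. s \<le> u_meas M x} \<le> emeasure lborel {x \<in> {-pi..pi}. s \<le> u_meas N x}"
proof (cases "{x \<in> {-pi..pi}. s \<le> u_meas M x} = {}")
  case False
  let ?U = "{x \<in> {-pi..pi}. s \<le> u_meas M x}"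
  have "closed ?U"
    using continuous_closed_preimage[of "{-pi..pi}" "u_meas M" "{s..}"] M.continuous_u
    by (simp add: vimage_def Int_def conj_commute)
  then have U: "compact ?U"
    unfolding compact_eq_bounded_closed by (auto intro: bounded_subset[OF bounded_closed_interval])
  obtain c where c: "c \<in> ?U" "\<And>x. x \<in> ?U \<Longrightarrow> c \<le> x"
    using compact_attains_inf[OF U False] by auto
  obtain d where d: "d \<in> ?U" "\<And>x. x \<in> ?U \<Longrightarrow> x \<le> d"
    using compact_attains_sup[OF U False] by auto
  \<comment> \<open>The potential vanishes at the endpoints, whereas the level is positive.\<close>
  have "c \<noteq> -pi" "d \<noteq> pi"
    using c(1) d(1) \<open>0 < s\<close> M.u_boundary by auto
  then have cd: "-pi < c" "c \<le> d" "d < pi"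
    using c d by fastforce+
  define r where "r = (d - c) / 2"
  have r: "0 \<le> r" "r < pi" using cd by (auto simp: r_def)
  have s: "s \<le> u_meas N r"
    unfolding r_def using cd c(1) d(1) by (intro talenti_comparison) auto
  have U_le: "emeasure lborel ?U \<le> emeasure lborel {c..d}"
    using c(2) d(2) by (intro emeasure_mono) auto
  have "d - c = r - -r"
    by (simp add: r_def)
  then have "emeasure lborel {c..d} = emeasure lborel {-r..r}"
    using cd r by simp
  with U_le have "emeasure lborel ?U \<le> emeasure lborel {-r..r}"
    by simp
  also have "\<dots> \<le> emeasure lborel {x \<in> {-pi..pi}. s \<le> u_meas N x}"
  proof (rule emeasure_mono)
    show "{-r..r} \<subseteq> {x \<in> {-pi..pi}. s \<le> u_meas N x}"
      using r s v_antimono[of _ r] by (force simp: abs_le_iff)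
    have "closed {x \<in> {-pi..pi}. s \<le> u_meas N x}"
      using continuous_closed_preimage[of "{-pi..pi}" "u_meas N" "{s..}"] N.continuous_u
      by (simp add: vimage_def Int_def conj_commute)
    then show "{x \<in> {-pi..pi}. s \<le> u_meas N x} \<in> sets lborel"
      by simp
  qed
  finally show ?thesis .
qed (simp only: emeasure_empty zero_le)

text \<open>The values at 0 are integrals of \<open>tent 0 0\<close>, whose layer at level
  \<open>s\<close> is the centred interval of radius \<open>pi - 2 * s\<close>; hence the masses
  agree for almost every radius. A strict inequality at radius \<open>\<rho>\<close> would persist
  on a whole range of smaller radii, by continuity of \<open>N\<close> from below and monotonicity
  of \<open>M\<close>.\<close>

lemma emeasure_centered_eq:
  assumes eq: "u_meas M 0 = u_meas N 0" and \<rho>: "0 < \<rho>" "\<rho> \<le> pi"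
  shows "emeasure M {-\<rho><..<\<rho>} = emeasure N {-\<rho><..<\<rho>}"
proof (rule ccontr)
  assume "\<not> ?thesis"
  moreover have le: "emeasure M {-\<sigma><..<\<sigma>} \<le> emeasure N {-\<sigma><..<\<sigma>}" if "0 < \<sigma>" "\<sigma> \<le> pi" for \<sigma>
    using dominated[of "-\<sigma>" \<sigma>] that by simp
  ultimately have lt: "emeasure M {-\<rho><..<\<rho>} < emeasure N {-\<rho><..<\<rho>}"
    using \<rho> by (simp add: less_le)
  define J where "J n = {-\<rho> + 1 / Suc n<..<\<rho> - 1 / Suc n}" for n
  have "emeasure N {-\<rho><..<\<rho>} = (SUP n. emeasure N (J n))"
  proof (subst SUP_emeasure_incseq)
    show "incseq J"
    proof (rule incseq_SucI)
      fix n
      have "1 / real (Suc (Suc n)) \<le> 1 / Suc n" by (simp add: field_simps)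
      then show "J n \<subseteq> J (Suc n)" by (auto simp: J_def simp del: of_nat_Suc)
    qed
    show "emeasure N {- \<rho><..<\<rho>} = emeasure N (\<Union> (range J))"
    proof (rule arg_cong[where f = "emeasure N"], safe)
      fix x assume "x \<in> {-\<rho><..<\<rho>}"
      then have "0 < \<rho> - \<bar>x\<bar>" by auto
      then obtain n where "1 / Suc n < \<rho> - \<bar>x\<bar>"
        using nat_approx_posE by blast
      then have "x \<in> J n" by (auto simp: J_def simp del: of_nat_Suc)
      then show "x \<in> \<Union> (range J)" by blast
    next
      fix x n assume "x \<in> J n"
      moreover have "0 < 1 / real (Suc n)" by simp
      ultimately show "x \<in> {-\<rho><..<\<rho>}"
        unfolding J_def by (smt (verit) greaterThanLessThan_iff)
    qed
  qed (auto simp: J_def N.sets_eq)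
  with lt obtain n where n: "emeasure M {-\<rho><..<\<rho>} < emeasure N (J n)"
    by (auto simp: less_SUP_iff)
  let ?f = "\<lambda>s. indicator {0<..} s * emeasure M {y. s < tent 0 0 y}"
  let ?g = "\<lambda>s. indicator {0<..} s * emeasure N {y. s < tent 0 0 y}"
  have f: "integral\<^sup>N lborel ?f = ennreal (u_meas M 0)"
    using nn_integral_layer_cake(1)[OF M.sigma_finite_measure_axioms, of "tent 0 0"]
      M.nn_integral_tent[of 0 0] M.u_combination_eq_tent[of 0 0]
    by (simp add: field_simps power2_eq_square)
  have g: "integral\<^sup>N lborel ?g = ennreal (u_meas N 0)"
    using nn_integral_layer_cake(1)[OF N.sigma_finite_measure_axioms, of "tent 0 0"]
      N.nn_integral_tent[of 0 0] v_eq_tent[of 0] by simp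
  have AE_eq: "AE s in lborel. ?f s = ?g s"
  proof (rule nn_integral_eq_imp_AE_eq)
    show "?f \<in> borel_measurable lborel"
      using borel_measurable_superlevel[OF M.sigma_finite_measure_axioms, of "tent 0 0"] by simp
    show "?g \<in> borel_measurable lborel"
      using borel_measurable_superlevel[OF N.sigma_finite_measure_axioms, of "tent 0 0"] by simp
    show "?f s \<le> ?g s" for s
      using tent_superlevel_le[of 0 0 s] by (auto split: split_indicator)
    show "integral\<^sup>N lborel ?f = integral\<^sup>N lborel ?g" "integral\<^sup>N lborel ?f \<noteq> \<infinity>"
      using f g eq by auto
  qed
  \<comment> \<open>Under \<open>\<sigma> = pi - 2 * s\<close> this window of levels corresponds to
    radii between \<open>\<rho> - 1 / Suc n\<close> and \<open>\<rho>\<close>; the maximum with 0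
    keeps them positive.\<close>
  have "(pi - \<rho>) / 2 < (pi - max 0 (\<rho> - 1 / Suc n)) / 2"
    using \<rho> by (auto simp: max_def)
  from AE_lborel_imp_ex_in_interval[OF AE_eq this]
  obtain s where "s \<in> {(pi - \<rho>) / 2<..<(pi - max 0 (\<rho> - 1 / Suc n)) / 2}" "?f s = ?g s"
    by blast
  then have s: "(pi - \<rho>) / 2 < s" "s < (pi - max 0 (\<rho> - 1 / Suc n)) / 2" "?f s = ?g s"
    by (simp_all only: greaterThanLessThan_iff)
  define \<sigma> where "\<sigma> = pi - 2 * s"
  have s0: "0 < s" using s(1) \<rho>(2) by simp
  have \<sigma>: "0 < \<sigma>" "\<sigma> < \<rho>" "\<rho> - 1 / Suc n < \<sigma>"
    using s(1,2) by (auto simp: \<sigma>_def)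
  have "{y. s < tent 0 0 y} = {-\<sigma><..<\<sigma>}"
    using tent_superlevel[of 0 0 s] s0 \<sigma>(1) by (simp add: \<sigma>_def)
  then have "emeasure M {-\<sigma><..<\<sigma>} = emeasure N {-\<sigma><..<\<sigma>}"
    using s(3) s0 by simp
  moreover have "emeasure M {-\<sigma><..<\<sigma>} \<le> emeasure M {-\<rho><..<\<rho>}"
    using \<sigma> by (intro emeasure_mono) (auto simp: M.sets_eq)
  moreover have "emeasure N (J n) \<le> emeasure N {-\<sigma><..<\<sigma>}"
    using \<sigma> by (intro emeasure_mono) (auto simp: J_def N.sets_eq)
  ultimately show False
    using n by simp
qed

end

section \<open>Norms of a potential in terms of its superlevel sets\<close>

context finite_measure_on_interval
begin

text \<open>Levels of the power are rewritten as levels of the potential itself, so that two such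
  integrals can be compared layer by layer through \<open>superlevel_le\<close>.\<close>

lemma ennreal_integral_u_powr:
  assumes "0 < q"
  shows "ennreal (\<integral>x. \<bar>u_meas M x\<bar> powr q \<partial>restrict_space lborel {-pi..pi}) =
    (\<integral>\<^sup>+s. indicator {0<..} s * emeasure lborel {x \<in> {-pi..pi}. s powr (1 / q) \<le> u_meas M x} \<partial>lborel)"
proof -
  let ?L = "restrict_space lborel {-pi..pi}"
  interpret L: finite_measure ?L
    by (rule finite_measureI) (simp add: emeasure_restrict_space space_restrict_space)
  have cont: "continuous_on {-pi..pi} (\<lambda>x. \<bar>u_meas M x\<bar> powr q)"
    using assms by (intro continuous_intros continuous_on_powr' continuous_u) auto
  have meas[measurable]: "(\<lambda>x. \<bar>u_meas M x\<bar> powr q) \<in> borel_measurable ?L"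
    using borel_measurable_continuous_on_restrict[OF cont]
    by (simp add: measurable_def sets_restrict_space space_restrict_space)
  \<comment> \<open>Boundedness yields integrability, without which the Bochner integral would take
    the default value 0.\<close>
  have "compact ((\<lambda>x. \<bar>u_meas M x\<bar> powr q) ` {-pi..pi})"
    by (rule compact_continuous_image[OF cont compact_Icc])
  then obtain B where "\<And>x. x \<in> {-pi..pi} \<Longrightarrow> norm (\<bar>u_meas M x\<bar> powr q) \<le> B"
    using compact_imp_bounded bounded_iff by (metis (no_types, lifting) image_eqI)
  then have int: "integrable ?L (\<lambda>x. \<bar>u_meas M x\<bar> powr q)"
    by (intro L.integrable_const_bound[where B = B] meas) (auto simp: space_restrict_space intro!: AE_I2)
  have "ennreal (\<integral>x. \<bar>u_meas M x\<bar> powr q \<partial>?L) = (\<integral>\<^sup>+x. ennreal (\<bar>u_meas M x\<bar> powr q) \<partial>?L)"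
    by (rule nn_integral_eq_integral[symmetric]) (use int in auto)
  also have "\<dots> = (\<integral>\<^sup>+s. indicator {0<..} s * emeasure ?L {x \<in> space ?L. s \<le> \<bar>u_meas M x\<bar> powr q} \<partial>lborel)"
    by (rule nn_integral_layer_cake(2)[OF L.sigma_finite_measure_axioms meas])
  also have "\<dots> = (\<integral>\<^sup>+s. indicator {0<..} s * emeasure lborel {x \<in> {-pi..pi}. s powr (1 / q) \<le> u_meas M x} \<partial>lborel)"
  proof (rule nn_integral_cong)
    fix s :: real
    have "s \<le> \<bar>u_meas M x\<bar> powr q \<longleftrightarrow> s powr (1 / q) \<le> u_meas M x" if "0 < s" "x \<in> {-pi..pi}" for x
    proof -
      have u: "0 \<le> u_meas M x" using that by (intro u_nonneg) auto
      have "s = (s powr (1 / q)) powr q" using assms that by (simp add: powr_powr)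
      then have "s \<le> \<bar>u_meas M x\<bar> powr q \<longleftrightarrow> (s powr (1 / q)) powr q \<le> u_meas M x powr q"
        using u by simp
      also have "\<dots> \<longleftrightarrow> s powr (1 / q) \<le> u_meas M x"
        using powr_mono2[of q "s powr (1 / q)" "u_meas M x"] powr_less_mono2[of q "u_meas M x" "s powr (1 / q)"] u assms
        by force
      finally show ?thesis .
    qed
    then have "0 < s \<Longrightarrow> {x \<in> space ?L. s \<le> \<bar>u_meas M x\<bar> powr q} = {x \<in> {-pi..pi}. s powr (1 / q) \<le> u_meas M x}"
      by (auto simp: space_restrict_space)
    then show "indicator {0<..} s * emeasure ?L {x \<in> space ?L. s \<le> \<bar>u_meas M x\<bar> powr q} =
       indicator {0<..} s * emeasure lborel {x \<in> {-pi..pi}. s powr (1 / q) \<le> u_meas M x}"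
      by (cases "0 < s") (simp_all add: emeasure_restrict_space del: mem_Collect_eq atLeastAtMost_iff)
  qed
  finally show ?thesis .
qed

lemma superlevel_measurable:
  "(\<lambda>s. indicator {0<..} s * emeasure lborel {x \<in> {-pi..pi}. s powr (1 / q) \<le> u_meas M x}) \<in> borel_measurable lborel"
proof -
  have [measurable]: "u_meas M \<in> borel_measurable borel"
    by (rule borel_measurable_continuous_onI[OF continuous_u])
  show ?thesis by measurable
qed

lemma Lp_norm_infinity:
  assumes "\<bar>x0\<bar> \<le> pi" "\<And>x. \<bar>x\<bar> \<le> pi \<Longrightarrow> u_meas M x \<le> u_meas M x0"
  shows "Lp_norm \<infinity> (u_meas M) = ereal (u_meas M x0)"
proof -
  have "Lp_norm \<infinity> (u_meas M) = ereal \<bar>u_meas M x0\<bar>"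
    unfolding Lp_norm_def if_P[OF refl]
    by (intro esssup_continuous_max continuous_intros continuous_u) (use assms u_nonneg in auto)
  then show ?thesis
    using u_nonneg[of x0] assms by simp
qed

lemma u_attains_max:
  obtains x0 where "\<bar>x0\<bar> \<le> pi" "\<And>x. \<bar>x\<bar> \<le> pi \<Longrightarrow> u_meas M x \<le> u_meas M x0"
proof -
  obtain x0 where "x0 \<in> {-pi..pi}" "\<forall>x\<in>{-pi..pi}. u_meas M x \<le> u_meas M x0"
    using continuous_attains_sup[OF compact_Icc _ continuous_u, of "-pi" pi] by auto
  then show ?thesis by (intro that[of x0]) (auto simp: abs_le_iff)
qed

end

section \<open>Comparison of the norms and what equality says about the maxima\<close>

context radial_domination
begin

lemma u_le_max: "\<bar>x\<bar> \<le> pi \<Longrightarrow> u_meas M x \<le> u_meas N 0"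
proof -
  assume x: "\<bar>x\<bar> \<le> pi"
  have "(1 - x\<^sup>2 / pi\<^sup>2) * u_meas N 0 \<le> 1 * u_meas N 0"
    by (intro mult_right_mono N.u_nonneg) auto
  with u_le_center[OF x] show ?thesis by simp
qed

lemma v_le_max: "\<bar>x\<bar> \<le> pi \<Longrightarrow> u_meas N x \<le> u_meas N 0"
proof -
  assume x: "\<bar>x\<bar> \<le> pi"
  show ?thesis
  proof (cases "\<bar>x\<bar> = pi")
    case True
    then have "x = pi \<or> x = -pi" by linarith
    then have "u_meas N x = 0" using N.u_boundary by auto
    then show ?thesis using N.u_nonneg[of 0] by simp
  next
    case False
    with x have "u_meas N \<bar>x\<bar> \<le> u_meas N 0" by (intro v_antimono) auto
    then show ?thesis by (auto simp: abs_if v_even split: if_splits)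
  qed
qed

text \<open>By continuity at 0. A gap between the maxima of the two potentials thus makes a whole
  range of layers differ.\<close>

lemma emeasure_superlevel_v_pos:
  assumes "z < u_meas N 0"
  shows "emeasure lborel {x \<in> {-pi..pi}. z \<le> u_meas N x} \<noteq> 0"
proof -
  have "\<exists>d>0. \<forall>x\<in>UNIV. dist x 0 < d \<longrightarrow> dist (u_meas N x) (u_meas N 0) < u_meas N 0 - z"
    using N.continuous_u[of UNIV] assms by (meson UNIV_I continuous_on_iff diff_gt_0_iff_gt)
  then obtain d where d: "d > 0" "\<And>x. \<bar>x\<bar> < d \<Longrightarrow> \<bar>u_meas N x - u_meas N 0\<bar> < u_meas N 0 - z"
    by (auto simp: dist_real_def)
  define e where "e = min d pi"
  have "{-e<..<e} \<subseteq> {x \<in> {-pi..pi}. z \<le> u_meas N x}"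
  proof
    fix x assume "x \<in> {-e<..<e}"
    then have "\<bar>x\<bar> < d" "\<bar>x\<bar> < pi"
      unfolding e_def by auto
    with d(2)[of x] show "x \<in> {x \<in> {-pi..pi}. z \<le> u_meas N x}"
      by auto
  qed
  moreover have [measurable]: "u_meas N \<in> borel_measurable borel"
    by (rule borel_measurable_continuous_onI[OF N.continuous_u])
  ultimately have "emeasure lborel {-e<..<e} \<le> emeasure lborel {x \<in> {-pi..pi}. z \<le> u_meas N x}"
    by (intro emeasure_mono) auto
  moreover have "0 < emeasure lborel {-e<..<e}"
    using d(1) by (cases "d \<le> pi") (simp_all add: e_def)
  ultimately show ?thesis by auto
qed

text \<open>For equality, suppose the maximum of the first potential were below
  \<open>u_meas N 0\<close>. At every level between the \<open>q\<close>-th powers of these values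
  the first layer is empty and the second has positive length, against equality at almost every
  level.\<close>

lemma integral_powr_le:
  fixes q :: real
  assumes "0 < q"
  defines "I \<equiv> \<lambda>u. \<integral>x. \<bar>u x\<bar> powr q \<partial>restrict_space lborel {-pi..pi}"
  shows "I (u_meas M) \<le> I (u_meas N)"
    and "I (u_meas M) = I (u_meas N) \<Longrightarrow> \<exists>x. \<bar>x\<bar> \<le> pi \<and> u_meas M x = u_meas N 0"
proof -
  let ?f = "\<lambda>s. indicator {0<..} s * emeasure lborel {x \<in> {-pi..pi}. s powr (1 / q) \<le> u_meas M x}"
  let ?g = "\<lambda>s. indicator {0<..} s * emeasure lborel {x \<in> {-pi..pi}. s powr (1 / q) \<le> u_meas N x}"
  have f: "integral\<^sup>N lborel ?f = ennreal (I (u_meas M))" and g: "integral\<^sup>N lborel ?g = ennreal (I (u_meas N))"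
    unfolding I_def using assms(1) by (simp_all add: M.ennreal_integral_u_powr N.ennreal_integral_u_powr)
  have le: "?f s \<le> ?g s" for s
    using superlevel_le[of "s powr (1 / q)"] by (auto split: split_indicator)
  have "ennreal (I (u_meas M)) \<le> ennreal (I (u_meas N))"
    unfolding f[symmetric] g[symmetric] by (intro nn_integral_mono le)
  moreover have "0 \<le> I (u_meas N)"
    unfolding I_def by (intro integral_nonneg_AE AE_I2) simp
  ultimately show "I (u_meas M) \<le> I (u_meas N)"
    by simp
  assume eq: "I (u_meas M) = I (u_meas N)"
  obtain x0 where x0: "\<bar>x0\<bar> \<le> pi" "\<And>x. \<bar>x\<bar> \<le> pi \<Longrightarrow> u_meas M x \<le> u_meas M x0"
    using M.u_attains_max by blast
  have "u_meas M x0 = u_meas N 0"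
  proof (rule ccontr)
    assume "u_meas M x0 \<noteq> u_meas N 0"
    then have lt: "u_meas M x0 < u_meas N 0" using u_le_max[OF x0(1)] by simp
    have AE_eq: "AE s in lborel. ?f s = ?g s"
    proof (rule nn_integral_eq_imp_AE_eq[OF M.superlevel_measurable N.superlevel_measurable le])
      show "integral\<^sup>N lborel ?f = integral\<^sup>N lborel ?g" "integral\<^sup>N lborel ?f \<noteq> \<infinity>"
        unfolding f g eq by simp_all
    qed
    have "u_meas M x0 powr q < u_meas N 0 powr q"
      using lt assms(1) M.u_nonneg[OF x0(1)] by (intro powr_less_mono2) auto
    from AE_lborel_imp_ex_in_interval[OF AE_eq this]
    obtain s where "s \<in> {u_meas M x0 powr q<..<u_meas N 0 powr q}" "?f s = ?g s"
      by blast
    then have s: "u_meas M x0 powr q < s" "s < u_meas N 0 powr q" "?f s = ?g s"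
      by (simp_all only: greaterThanLessThan_iff)
    have s0: "0 < s" using s(1) powr_ge_zero[of "u_meas M x0" q] by linarith
    have v0: "0 \<le> u_meas N 0" by (simp add: N.u_nonneg)
    have inv: "(a powr q) powr (1 / q) = a" if "0 \<le> a" for a :: real
      using assms(1) that by (simp add: powr_powr)
    have "u_meas M x0 < s powr (1 / q)"
      using powr_less_mono2[OF _ _ s(1), of "1 / q"] assms(1)
      unfolding inv[OF M.u_nonneg[OF x0(1)]] by simp
    then have "{x \<in> {-pi..pi}. s powr (1 / q) \<le> u_meas M x} = {}"
      using x0(2) by (metis (no_types, lifting) Collect_empty_eq abs_le_iff atLeastAtMost_iff leD le_less_trans minus_le_iff)
    then have "?f s = 0" by (simp only: emeasure_empty mult_zero_right)
    moreover have "s powr (1 / q) < u_meas N 0"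
      using powr_less_mono2[OF _ _ s(2), of "1 / q"] assms(1) s0
      unfolding inv[OF v0] by simp
    then have "?g s \<noteq> 0"
      using emeasure_superlevel_v_pos[of "s powr (1 / q)"] s0 by (simp del: mem_Collect_eq atLeastAtMost_iff)
    ultimately show False using s(3) by (simp only:)
  qed
  with x0(1) show "\<exists>x. \<bar>x\<bar> \<le> pi \<and> u_meas M x = u_meas N 0" by blast
qed

lemma Lp_norm_le:
  assumes "1 \<le> p"
  shows "Lp_norm p (u_meas M) \<le> Lp_norm p (u_meas N)"
    and "Lp_norm p (u_meas M) = Lp_norm p (u_meas N) \<Longrightarrow> \<exists>x. \<bar>x\<bar> \<le> pi \<and> u_meas M x = u_meas N 0"
proof -
  have "Lp_norm p (u_meas M) \<le> Lp_norm p (u_meas N) \<and>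
    (Lp_norm p (u_meas M) = Lp_norm p (u_meas N) \<longrightarrow> (\<exists>x. \<bar>x\<bar> \<le> pi \<and> u_meas M x = u_meas N 0))"
  proof (cases "p = \<infinity>")
    case True
    obtain x0 where x0: "\<bar>x0\<bar> \<le> pi" "\<And>x. \<bar>x\<bar> \<le> pi \<Longrightarrow> u_meas M x \<le> u_meas M x0"
      using M.u_attains_max by blast
    have "Lp_norm p (u_meas M) = ereal (u_meas M x0)"
      using True x0 M.Lp_norm_infinity by blast
    moreover have "Lp_norm p (u_meas N) = ereal (u_meas N 0)"
      using True v_le_max N.Lp_norm_infinity[of 0] by simp
    ultimately show ?thesis
      using x0(1) u_le_max[OF x0(1)] by auto
  next
    case False
    with assms obtain q where q: "p = ereal q" "1 \<le> q"
      by (cases p) (auto simp: one_ereal_def)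
    let ?I = "\<lambda>u. \<integral>x. \<bar>u x\<bar> powr q \<partial>restrict_space lborel {-pi..pi}"
    have norm: "Lp_norm p u = ereal (?I u powr (1 / q))" for u
      by (simp add: Lp_norm_def q)
    have nonneg: "0 \<le> ?I u" for u :: "real \<Rightarrow> real"
      by (intro integral_nonneg_AE AE_I2) simp
    have le: "?I (u_meas M) \<le> ?I (u_meas N)"
      using q by (intro integral_powr_le) auto
    have "?I (u_meas M) = ?I (u_meas N)" if "?I (u_meas M) powr (1 / q) = ?I (u_meas N) powr (1 / q)"
      using powr_less_mono2[of "1 / q" "?I (u_meas M)" "?I (u_meas N)"] le that q nonneg[of "u_meas M"] by force
    then show ?thesis
      unfolding norm using powr_mono2[OF _ nonneg le, of "1 / q"] q integral_powr_le(2)[of q] by auto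
  qed
  then show "Lp_norm p (u_meas M) \<le> Lp_norm p (u_meas N)"
    and "Lp_norm p (u_meas M) = Lp_norm p (u_meas N) \<Longrightarrow> \<exists>x. \<bar>x\<bar> \<le> pi \<and> u_meas M x = u_meas N 0"
    by auto
qed

text \<open>A nonzero \<open>M\<close> makes \<open>u_meas N 0\<close> positive, so it cancels in
  \<open>u_le_center\<close> at the point where the maxima agree. What remains,
  \<open>1 \<le> 1 - x\<^sup>2 / pi\<^sup>2\<close>, forces this point to be the origin.\<close>

lemma Lp_norm_eq_imp_emeasure_centered_eq:
  assumes "emeasure M UNIV \<noteq> 0" "1 \<le> p" "Lp_norm p (u_meas M) = Lp_norm p (u_meas N)"
    "0 < \<rho>" "\<rho> \<le> pi"
  shows "emeasure M {-\<rho><..<\<rho>} = emeasure N {-\<rho><..<\<rho>}"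
proof (rule emeasure_centered_eq)
  obtain x where x: "\<bar>x\<bar> \<le> pi" "u_meas M x = u_meas N 0"
    using Lp_norm_le(2) assms by blast
  have "0 < u_meas N 0"
    using M.u_pos[OF assms(1)] u_le_max[of 0] by simp
  then have "x = 0"
    using u_le_center[OF x(1)] x(2) mult_le_cancel_right[of 1 "u_meas N 0" "1 - x\<^sup>2 / pi\<^sup>2"]
    by (simp add: divide_le_0_iff)
  with x(2) show "u_meas M 0 = u_meas N 0" by simp
qed (use assms in auto)

end

section \<open>The symmetric decreasing rearrangement\<close>

locale nonneg_function =
  fixes f :: "real \<Rightarrow> real"
  assumes f_meas[measurable]: "f \<in> borel_measurable borel" and f_nonneg: "0 \<le> f x"
begin

definition superlevel :: "real \<Rightarrow> real set" where "superlevel s = {x \<in> {-pi<..<pi}. s < f x}"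

definition vol :: "real \<Rightarrow> real" where "vol s = measure lborel (superlevel s)"

text \<open>Unlike \<^const>\<open>symm_rearr\<close>, this version carries no junk values: at the origin
  the infimum may range over the empty set, and off the interval over all of the reals.\<close>
definition rearr :: "real \<Rightarrow> real" where "rearr x = (if 0 < \<bar>x\<bar> \<and> \<bar>x\<bar> < pi then symm_rearr f x else 0)"

lemma superlevel_sets[measurable]: "superlevel s \<in> sets borel"
  unfolding superlevel_def by measurable

lemma superlevel_subset: "superlevel s \<subseteq> {-pi<..<pi}"
  by (auto simp: superlevel_def)

lemma superlevel_antimono: "s \<le> s' \<Longrightarrow> superlevel s' \<subseteq> superlevel s"
  by (auto simp: superlevel_def)

lemma emeasure_superlevel: "emeasure lborel (superlevel s) = ennreal (vol s)"
proof -
  have "emeasure lborel (superlevel s) \<le> emeasure lborel {-pi<..<pi}"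
    by (intro emeasure_mono superlevel_subset) auto
  then have "emeasure lborel (superlevel s) \<noteq> \<infinity>"
    by (auto simp: top_unique)
  then show ?thesis
    by (simp add: vol_def emeasure_eq_ennreal_measure)
qed

lemma vol_nonneg: "0 \<le> vol s"
  by (simp add: vol_def)

lemma vol_antimono: "s \<le> s' \<Longrightarrow> vol s' \<le> vol s"
  using emeasure_mono[OF superlevel_antimono, of s s' lborel] vol_nonneg by (simp add: emeasure_superlevel)

lemma vol_le: "vol s \<le> 2 * pi"
  using emeasure_mono[OF superlevel_subset, of lborel s] by (simp add: emeasure_superlevel)

lemma vol_neg: "s < 0 \<Longrightarrow> vol s = 2 * pi"
proof -
  assume "s < 0"
  then have "superlevel s = {-pi<..<pi}"
    using less_le_trans[OF _ f_nonneg] by (auto simp: superlevel_def)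
  then show ?thesis by (simp add: vol_def)
qed

text \<open>As \<open>f\<close> is real-valued, its superlevel sets decrease to the empty set. This
  makes the infimum in \<open>decr_rearr\<close> range over a nonempty set for positive
  arguments.\<close>

lemma ex_vol_less: "0 < t \<Longrightarrow> \<exists>s. vol s < t"
proof -
  assume "0 < t"
  have "(\<lambda>n. vol (real n)) \<longlonglongrightarrow> measure lborel (\<Inter>n. superlevel (real n))"
    unfolding vol_def
    by (intro Lim_measure_decseq) (auto simp: emeasure_superlevel intro!: decseq_SucI superlevel_antimono)
  moreover have "(\<Inter>n. superlevel (real n)) = {}"
  proof safe
    fix x assume x: "x \<in> (\<Inter>n. superlevel (real n))"
    obtain n where "f x < real n" using reals_Archimedean2 by blast
    moreover have "x \<in> superlevel (real n)" using x by blast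
    ultimately show "x \<in> {}" by (simp add: superlevel_def)
  qed
  ultimately have "(\<lambda>n. vol (real n)) \<longlonglongrightarrow> 0" by simp
  then have "eventually (\<lambda>n. vol (real n) < t) sequentially"
    using \<open>0 < t\<close> by (rule order_tendstoD(2))
  then show ?thesis
    by (auto simp: eventually_sequentially)
qed

text \<open>Strict superlevel sets increase to \<open>superlevel s\<close> as the level falls to
  \<open>s\<close>. This gives the strict inequality in \<open>less_symm_rearr_iff\<close>.\<close>

lemma vol_right_continuous: "t < vol s \<Longrightarrow> \<exists>s'>s. t < vol s'"
proof -
  assume "t < vol s"
  have "(\<lambda>n. vol (s + 1 / Suc n)) \<longlonglongrightarrow> measure lborel (\<Union>n. superlevel (s + 1 / Suc n))"
    unfolding vol_def
  proof (intro Lim_measure_incseq)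
    show "incseq (\<lambda>n. superlevel (s + 1 / Suc n))"
      by (intro incseq_SucI superlevel_antimono) (simp add: field_simps)
    have "emeasure lborel (\<Union>n. superlevel (s + 1 / Suc n)) \<le> emeasure lborel {-pi<..<pi}"
      by (intro emeasure_mono) (auto simp: superlevel_def)
    then show "emeasure lborel (\<Union>n. superlevel (s + 1 / Suc n)) \<noteq> \<infinity>"
      by (auto simp: top_unique)
  qed auto
  moreover have "(\<Union>n. superlevel (s + 1 / Suc n)) = superlevel s"
  proof safe
    fix x n assume "x \<in> superlevel (s + 1 / Suc n)"
    then show "x \<in> superlevel s" using superlevel_antimono[of s "s + 1 / Suc n"] by auto
  next
    fix x assume x: "x \<in> superlevel s"
    then have "0 < f x - s" by (simp add: superlevel_def)
    then obtain n where "1 / Suc n < f x - s" using nat_approx_posE by blast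
    then have "x \<in> superlevel (s + 1 / Suc n)" using x by (auto simp: superlevel_def)
    then show "x \<in> (\<Union>n. superlevel (s + 1 / Suc n))" by blast
  qed
  ultimately have "(\<lambda>n. vol (s + 1 / Suc n)) \<longlonglongrightarrow> vol s" by (simp add: vol_def)
  then have "eventually (\<lambda>n. t < vol (s + 1 / Suc n)) sequentially"
    using \<open>t < vol s\<close> by (rule order_tendstoD(1))
  then obtain n where "t < vol (s + 1 / Suc n)"
    by (auto simp: eventually_sequentially)
  then show ?thesis
    by (intro exI[of _ "s + 1 / Suc n"]) simp
qed

text \<open>The rearrangement is a generalized inverse of \<open>vol\<close>. The condition
  \<open>0 < \<bar>x\<bar>\<close> makes the set under the infimum nonempty;
  \<open>\<bar>x\<bar> < pi\<close> bounds it below, because negative levels have volume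
  \<open>2 * pi\<close>.\<close>

lemma less_symm_rearr_iff:
  assumes "0 < \<bar>x\<bar>" "\<bar>x\<bar> < pi"
  shows "s < symm_rearr f x \<longleftrightarrow> 2 * \<bar>x\<bar> < vol s"
proof -
  define X where "X = {s. vol s \<le> 2 * \<bar>x\<bar>}"
  have X: "symm_rearr f x = Inf X"
    unfolding symm_rearr_def decr_rearr_def superlevel_def[symmetric] emeasure_superlevel X_def by simp
  have "0 \<le> s" if "s \<in> X" for s
    using that vol_neg[of s] assms by (force simp: X_def)
  then have bdd: "bdd_below X" by (rule bdd_belowI)
  have ne: "X \<noteq> {}"
    using ex_vol_less[of "2 * \<bar>x\<bar>"] assms by (auto simp: X_def intro: less_imp_le)
  show ?thesis
  proof
    assume "s < symm_rearr f x"
    then have "s \<notin> X" using cInf_lower[OF _ bdd, of s] by (auto simp: X)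
    then show "2 * \<bar>x\<bar> < vol s" by (simp add: X_def)
  next
    assume "2 * \<bar>x\<bar> < vol s"
    then obtain s' where s': "s < s'" "2 * \<bar>x\<bar> < vol s'" using vol_right_continuous by blast
    have "s' \<le> Inf X"
    proof (rule cInf_greatest[OF ne])
      fix a assume "a \<in> X"
      then have "vol a < vol s'" using s'(2) by (simp add: X_def)
      then show "s' \<le> a" using vol_antimono[of a s'] by linarith
    qed
    with s'(1) show "s < symm_rearr f x" by (simp add: X)
  qed
qed

lemma rearr_nonneg: "0 \<le> rearr x"
proof (rule ccontr)
  assume *: "\<not> ?thesis"
  then have x: "0 < \<bar>x\<bar>" "\<bar>x\<bar> < pi" "rearr x = symm_rearr f x"
    by (auto simp: rearr_def split: if_splits)
  then show False
    using less_symm_rearr_iff[OF x(1,2), of "rearr x"] vol_neg[of "rearr x"] * by simp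
qed

lemma less_rearr_iff: "0 \<le> s \<Longrightarrow> s < rearr x \<longleftrightarrow> 0 < \<bar>x\<bar> \<and> 2 * \<bar>x\<bar> < vol s"
  using less_symm_rearr_iff[of x s] vol_le[of s] by (auto simp: rearr_def)

lemma rearr_even: "rearr (-x) = rearr x"
  by (simp add: rearr_def symm_rearr_def)

lemma rearr_meas[measurable]: "rearr \<in> borel_measurable borel"
  unfolding borel_measurable_iff_greater
proof
  fix s
  show "{w \<in> space borel. s < rearr w} \<in> sets borel"
  proof (cases "0 \<le> s")
    case True
    then have "{w \<in> space borel. s < rearr w} = {x. 0 < \<bar>x\<bar> \<and> 2 * \<bar>x\<bar> < vol s}"
      by (simp add: less_rearr_iff)
    also have "\<dots> \<in> sets borel" by measurable
    finally show ?thesis .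
  next
    case False
    then have "{w \<in> space borel. s < rearr w} = UNIV"
      using less_le_trans[OF _ rearr_nonneg] by auto
    then show ?thesis by simp
  qed
qed

lemma nn_integral_f:
  assumes [measurable]: "B \<in> sets borel" and B: "B \<subseteq> {-pi<..<pi}"
  shows "(\<integral>\<^sup>+x. ennreal (f x) * indicator B x \<partial>lborel) =
    (\<integral>\<^sup>+s. indicator {0<..} s * emeasure lborel (B \<inter> superlevel s) \<partial>lborel)"
proof -
  have "(\<integral>\<^sup>+x. ennreal (f x) * indicator B x \<partial>lborel) = (\<integral>\<^sup>+x. ennreal (f x * indicator B x) \<partial>lborel)"
    by (intro nn_integral_cong) (auto split: split_indicator)
  also have "\<dots> = (\<integral>\<^sup>+s. indicator {0<..} s * emeasure lborel {x. s < f x * indicator B x} \<partial>lborel)"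
    using nn_integral_layer_cake(1)[OF lborel.sigma_finite_measure_axioms, of "\<lambda>x. f x * indicator B x"] by simp
  also have "\<dots> = (\<integral>\<^sup>+s. indicator {0<..} s * emeasure lborel (B \<inter> superlevel s) \<partial>lborel)"
  proof (rule nn_integral_cong)
    fix s :: real
    have "{x. s < f x * indicator B x} = B \<inter> superlevel s" if "0 < s"
      using that B by (auto simp: superlevel_def split: split_indicator)
    then show "indicator {0<..} s * emeasure lborel {x. s < f x * indicator B x} =
        indicator {0<..} s * emeasure lborel (B \<inter> superlevel s)"
      by (cases "0 < s") auto
  qed
  finally show ?thesis .
qed

lemma nn_integral_rearr:
  assumes [measurable]: "B \<in> sets borel"
  shows "(\<integral>\<^sup>+x. ennreal (rearr x) * indicator B x \<partial>lborel) =
    (\<integral>\<^sup>+s. indicator {0<..} s * emeasure lborel (B \<inter> {- (vol s / 2)<..<vol s / 2}) \<partial>lborel)"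
proof -
  have "(\<integral>\<^sup>+x. ennreal (rearr x) * indicator B x \<partial>lborel) = (\<integral>\<^sup>+x. ennreal (rearr x * indicator B x) \<partial>lborel)"
    by (intro nn_integral_cong) (auto split: split_indicator)
  also have "\<dots> = (\<integral>\<^sup>+s. indicator {0<..} s * emeasure lborel {x. s < rearr x * indicator B x} \<partial>lborel)"
    using nn_integral_layer_cake(1)[OF lborel.sigma_finite_measure_axioms, of "\<lambda>x. rearr x * indicator B x"] by simp
  also have "\<dots> = (\<integral>\<^sup>+s. indicator {0<..} s * emeasure lborel (B \<inter> {- (vol s / 2)<..<vol s / 2}) \<partial>lborel)"
  proof (rule nn_integral_cong)
    fix s :: real
    have "emeasure lborel {x. s < rearr x * indicator B x} = emeasure lborel (B \<inter> {- (vol s / 2)<..<vol s / 2})" if "0 < s"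
    proof (rule emeasure_eq_AE)
      show "AE x in lborel. x \<in> {x. s < rearr x * indicator B x} \<longleftrightarrow> x \<in> B \<inter> {- (vol s / 2)<..<vol s / 2}"
        \<comment> \<open>\<open>rearr\<close> is 0 at the origin, while the centred interval
          contains the origin as soon as it is nonempty.\<close>
        using AE_lborel_singleton[of 0]
      proof eventually_elim
        case (elim x)
        then have "s < rearr x \<longleftrightarrow> x \<in> {- (vol s / 2)<..<vol s / 2}"
          using that by (auto simp: less_rearr_iff abs_if)
        then show ?case
          using that by (auto split: split_indicator)
      qed
    qed auto
    then show "indicator {0<..} s * emeasure lborel {x. s < rearr x * indicator B x} =
        indicator {0<..} s * emeasure lborel (B \<inter> {- (vol s / 2)<..<vol s / 2})"
      by (cases "0 < s") auto
  qed
  finally show ?thesis .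
qed

lemma emeasure_centered_Int:
  fixes r k :: real
  assumes "0 \<le> r" "0 \<le> k"
  shows "emeasure lborel ({-r<..<r} \<inter> {-k<..<k}) = min (ennreal (2 * r)) (ennreal (2 * k))"
proof (cases "r \<le> k")
  case True
  then have "{-r<..<r} \<inter> {-k<..<k} = {-r<..<r}" by auto
  with True assms show ?thesis by (simp add: min_def)
next
  case False
  then have "{-r<..<r} \<inter> {-k<..<k} = {-k<..<k}" by auto
  with False assms show ?thesis by (simp add: min_def)
qed

text \<open>A Hardy-Littlewood bound, proved layer by layer: \<open>B \<inter> superlevel s\<close>
  is no larger than either set, and nested centred intervals attain the minimum of the two
  sizes.\<close>

lemma nn_integral_le_rearrangement:
  assumes [measurable]: "B \<in> sets borel" and B: "B \<subseteq> {-pi<..<pi}"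
    and r: "0 \<le> r" "emeasure lborel B \<le> ennreal (2 * r)"
  shows "(\<integral>\<^sup>+x. ennreal (f x) * indicator B x \<partial>lborel)
    \<le> (\<integral>\<^sup>+x. ennreal (rearr x) * indicator {-r<..<r} x \<partial>lborel)"
proof -
  have "emeasure lborel (B \<inter> superlevel s) \<le> emeasure lborel ({-r<..<r} \<inter> {- (vol s / 2)<..<vol s / 2})" for s
  proof -
    have "emeasure lborel (B \<inter> superlevel s) \<le> emeasure lborel B" "emeasure lborel (B \<inter> superlevel s) \<le> emeasure lborel (superlevel s)"
      by (auto intro!: emeasure_mono)
    then have "emeasure lborel (B \<inter> superlevel s) \<le> min (ennreal (2 * r)) (ennreal (vol s))"
      using r by (auto simp: emeasure_superlevel)
    then show ?thesis
      using emeasure_centered_Int[of r "vol s / 2"] r vol_nonneg[of s] by simp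
  qed
  then show ?thesis
    using B by (simp add: nn_integral_f nn_integral_rearr mult_left_mono nn_integral_mono)
qed

text \<open>Superlevel sets are themselves nested, so for them every layer attains the minimum and
  the bound is an equality.\<close>

lemma nn_integral_superlevel:
  "(\<integral>\<^sup>+x. ennreal (f x) * indicator (superlevel s) x \<partial>lborel)
    = (\<integral>\<^sup>+x. ennreal (rearr x) * indicator {- (vol s / 2)<..<vol s / 2} x \<partial>lborel)"
proof -
  have "emeasure lborel (superlevel s \<inter> superlevel t) = emeasure lborel ({- (vol s / 2)<..<vol s / 2} \<inter> {- (vol t / 2)<..<vol t / 2})" for t
  proof (cases "s \<le> t")
    case True
    then show ?thesis
      using superlevel_antimono[of s t] vol_antimono[of s t] vol_nonneg
      by (simp add: emeasure_centered_Int inf.absorb2 emeasure_superlevel min.absorb2)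
  next
    case False
    then show ?thesis
      using superlevel_antimono[of t s] vol_antimono[of t s] vol_nonneg
      by (simp add: emeasure_centered_Int inf.absorb1 emeasure_superlevel min.absorb1)
  qed
  then show ?thesis
    by (simp add: nn_integral_f[OF superlevel_sets superlevel_subset] nn_integral_rearr)
qed

lemma nn_integral_rearr_eq:
  "(\<integral>\<^sup>+x. ennreal (rearr x) \<partial>lborel) = (\<integral>\<^sup>+x. ennreal (f x) * indicator {-pi<..<pi} x \<partial>lborel)"
proof -
  have "{-pi<..<pi} \<inter> superlevel s = superlevel s" for s
    using superlevel_subset by auto
  then show ?thesis
    using nn_integral_rearr[of UNIV] vol_nonneg by (simp add: nn_integral_f emeasure_superlevel)
qed

text \<open>The superlevel set and the centred interval \<open>J\<close> of the same length carry
  the same integral of \<open>f\<close>, so their two differences have equal size and equal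
  integral. But \<open>f\<close> exceeds \<open>s\<close> on \<open>superlevel s - J\<close> and is
  at most \<open>s\<close> on \<open>J - superlevel s\<close>, so both are null.\<close>

lemma superlevel_AE_centered:
  assumes fin: "(\<integral>\<^sup>+x. ennreal (f x) * indicator {-pi<..<pi} x \<partial>lborel) \<noteq> \<infinity>"
    and eq: "\<And>r. 0 < r \<Longrightarrow> r \<le> pi \<Longrightarrow> (\<integral>\<^sup>+x. ennreal (f x) * indicator {-r<..<r} x \<partial>lborel)
      = (\<integral>\<^sup>+x. ennreal (rearr x) * indicator {-r<..<r} x \<partial>lborel)"
    and "0 \<le> s"
  shows "AE x in lborel. x \<in> superlevel s \<longleftrightarrow> x \<in> {- (vol s / 2)<..<vol s / 2}"
proof -
  define J where "J = {- (vol s / 2)<..<vol s / 2}"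
  let ?I = "\<lambda>B. \<integral>\<^sup>+x. ennreal (f x) * indicator B x \<partial>lborel"
  have [measurable]: "J \<in> sets borel" by (simp add: J_def)
  have J_subset: "J \<subseteq> {-pi<..<pi}"
    using vol_le[of s] by (auto simp: J_def)
  have eJ: "emeasure lborel J = ennreal (vol s)"
    using vol_nonneg[of s] by (simp add: J_def)
  \<comment> \<open>\<open>nn_integral_superlevel\<close> passes to \<open>rearr\<close> on
    \<open>J\<close>, and the hypothesis at radius \<open>vol s / 2\<close> leads back to
    \<open>f\<close>. Radius 0 is outside that hypothesis and is treated separately.\<close>
  have "?I (superlevel s) = ?I J"
  proof (cases "vol s = 0")
    case True
    then have "J = {}" by (simp add: J_def)
    moreover have "?I (superlevel s) = 0"
      using nn_integral_superlevel[of s] True by simp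
    ultimately show ?thesis by simp
  next
    case False
    then show ?thesis
      using eq[of "vol s / 2"] vol_nonneg[of s] vol_le[of s] by (simp add: nn_integral_superlevel J_def)
  qed
  have split: "?I B = ?I (B \<inter> C) + ?I (B - C)" if [measurable]: "B \<in> sets borel" "C \<in> sets borel" for B C
    by (subst nn_integral_add[symmetric]) (auto intro!: nn_integral_cong split: split_indicator)
  have I_fin: "?I B \<noteq> \<infinity>" if "B \<subseteq> {-pi<..<pi}" for B
  proof -
    have "?I B \<le> ?I {-pi<..<pi}"
      using that by (intro nn_integral_mono) (auto split: split_indicator)
    with fin show ?thesis by (auto simp: top_unique)
  qed
  have "?I (superlevel s) = ?I (superlevel s \<inter> J) + ?I (superlevel s - J)" "?I J = ?I (superlevel s \<inter> J) + ?I (J - superlevel s)"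
    using split[of "superlevel s" J] split[of J "superlevel s"] by (simp_all add: Int_commute)
  with \<open>?I (superlevel s) = ?I J\<close> have "?I (superlevel s \<inter> J) + ?I (superlevel s - J) = ?I (superlevel s \<inter> J) + ?I (J - superlevel s)"
    by simp
  then have I_diff: "?I (superlevel s - J) = ?I (J - superlevel s)"
    using I_fin[of "superlevel s \<inter> J"] superlevel_subset[of s] by (subst (asm) ennreal_add_left_cancel) auto
  have "emeasure lborel (superlevel s \<inter> J) + emeasure lborel (superlevel s - J) = emeasure lborel (superlevel s)"
    by (subst plus_emeasure) (auto intro!: arg_cong[where f = "emeasure lborel"])
  moreover have "emeasure lborel (superlevel s \<inter> J) + emeasure lborel (J - superlevel s) = emeasure lborel J"
    by (subst plus_emeasure) (auto intro!: arg_cong[where f = "emeasure lborel"])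
  ultimately have "emeasure lborel (superlevel s \<inter> J) + emeasure lborel (superlevel s - J) = emeasure lborel (superlevel s \<inter> J) + emeasure lborel (J - superlevel s)"
    by (simp add: eJ emeasure_superlevel)
  moreover have "emeasure lborel (superlevel s \<inter> J) \<noteq> \<infinity>"
    using emeasure_mono[of "superlevel s \<inter> J" J lborel] eJ by (auto simp: top_unique)
  ultimately have e_diff: "emeasure lborel (superlevel s - J) = emeasure lborel (J - superlevel s)"
    by (subst (asm) ennreal_add_left_cancel) auto
  have "?I (J - superlevel s) \<le> (\<integral>\<^sup>+x. ennreal s * indicator (J - superlevel s) x \<partial>lborel)"
    using J_subset by (intro nn_integral_mono) (auto simp: superlevel_def intro!: ennreal_leI split: split_indicator)
  also have "\<dots> = (\<integral>\<^sup>+x. ennreal s * indicator (superlevel s - J) x \<partial>lborel)"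
    by (simp add: nn_integral_cmult_indicator e_diff)
  finally have "?I (superlevel s - J) \<le> (\<integral>\<^sup>+x. ennreal s * indicator (superlevel s - J) x \<partial>lborel)"
    by (simp add: I_diff)
  moreover have le: "ennreal s * indicator (superlevel s - J) x \<le> ennreal (f x) * indicator (superlevel s - J) x" for x
    by (auto simp: superlevel_def intro!: ennreal_leI split: split_indicator)
  moreover have "(\<integral>\<^sup>+x. ennreal s * indicator (superlevel s - J) x \<partial>lborel) \<le> ?I (superlevel s - J)"
    by (intro nn_integral_mono le)
  ultimately have "AE x in lborel. ennreal s * indicator (superlevel s - J) x = ennreal (f x) * indicator (superlevel s - J) x"
    using I_fin[of "superlevel s - J"] superlevel_subset[of s]
    by (intro nn_integral_eq_imp_AE_eq) (auto simp: top_unique)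
  then have "AE x in lborel. x \<notin> superlevel s - J"
  proof eventually_elim
    case (elim x)
    have False if "x \<in> superlevel s - J"
      using elim that \<open>0 \<le> s\<close> f_nonneg[of x] by (simp add: superlevel_def)
    then show ?case by blast
  qed
  then have null: "emeasure lborel (superlevel s - J) = 0"
    by (subst (asm) AE_iff_measurable[of "superlevel s - J"]) auto
  then have "AE x in lborel. x \<notin> J - superlevel s"
    unfolding e_diff by (subst AE_iff_measurable[of "J - superlevel s"]) auto
  with \<open>AE x in lborel. x \<notin> superlevel s - J\<close> show ?thesis
    by eventually_elim (auto simp: J_def[symmetric])
qed

text \<open>Rational levels leave only countably many null sets to discard, and two nonnegative
  reals coincide once the same nonnegative rationals lie below them.\<close>

lemma AE_eq_rearrangement:
  assumes "(\<integral>\<^sup>+x. ennreal (f x) * indicator {-pi<..<pi} x \<partial>lborel) \<noteq> \<infinity>"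
    and "\<And>r. 0 < r \<Longrightarrow> r \<le> pi \<Longrightarrow> (\<integral>\<^sup>+x. ennreal (f x) * indicator {-r<..<r} x \<partial>lborel)
      = (\<integral>\<^sup>+x. ennreal (rearr x) * indicator {-r<..<r} x \<partial>lborel)"
  shows "AE x in lborel. x \<in> {-pi<..<pi} \<longrightarrow> f x = rearr x"
proof -
  have "AE x in lborel. \<forall>q::rat. 0 \<le> q \<longrightarrow>
      (x \<in> superlevel (of_rat q) \<longleftrightarrow> x \<in> {- (vol (of_rat q) / 2)<..<vol (of_rat q) / 2})"
    unfolding AE_all_countable using superlevel_AE_centered[OF assms]
    by (auto simp: AE_conj_iff intro!: AE_impI)
  with AE_lborel_singleton[of 0] show ?thesis
  proof eventually_elim
    case (elim x)
    have iff: "of_rat q < f x \<longleftrightarrow> of_rat q < rearr x" if "0 \<le> q" "x \<in> {-pi<..<pi}" for q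
    proof -
      have "of_rat q < f x \<longleftrightarrow> x \<in> {- (vol (of_rat q) / 2)<..<vol (of_rat q) / 2}"
        using elim that by (auto simp: superlevel_def)
      also have "\<dots> \<longleftrightarrow> of_rat q < rearr x"
        using elim that by (auto simp: less_rearr_iff abs_if)
      finally show ?thesis .
    qed
    show ?case
    proof (intro impI, rule ccontr)
      assume x: "x \<in> {-pi<..<pi}" and "f x \<noteq> rearr x"
      then have "min (f x) (rearr x) < max (f x) (rearr x)" by auto
      then obtain q where q: "min (f x) (rearr x) < of_rat q" "of_rat q < max (f x) (rearr x)"
        using of_rat_dense by blast
      have "0 < (of_rat q :: real)"
        using q(1) f_nonneg[of x] rearr_nonneg[of x] by linarith
      then have "0 \<le> q" by (simp add: zero_less_of_rat_iff)
      from iff[OF this x] q show False by (auto simp: min_def max_def split: if_splits)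
    qed
  qed
qed

section \<open>The symmetrization as an even measure\<close>

lemma symmetrization_eq:
  "symmetrization f c = measure_of UNIV (sets borel)
    (\<lambda>B. (\<integral>\<^sup>+x. ennreal (rearr x) * indicator B x \<partial>lborel) + c * indicator B 0)"
proof -
  have "(\<integral>\<^sup>+x. ennreal (symm_rearr f x) * indicator ({-pi<..<pi} \<inter> B) x \<partial>lborel) =
      (\<integral>\<^sup>+x. ennreal (rearr x) * indicator B x \<partial>lborel)" for B
    \<comment> \<open>The integrands differ at most at the origin: \<open>rearr\<close> already
      vanishes off the interval.\<close>
    using AE_lborel_singleton[of 0]
    by (intro nn_integral_cong_AE) (auto elim!: eventually_mono simp: rearr_def abs_less_iff split: split_indicator)
  then show ?thesis
    by (simp add: symmetrization_def)
qed

lemma sets_symmetrization: "sets (symmetrization f c) = sets borel"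
  unfolding symmetrization_eq using sets.sets_measure_of_eq[of borel] by simp

text \<open>\<open>measure_of\<close> returns the prescribed values only for a countably additive
  set function. Additivity is inherited from a density and a point mass.\<close>

lemma emeasure_symmetrization:
  assumes "B \<in> sets borel"
  shows "emeasure (symmetrization f c) B = (\<integral>\<^sup>+x. ennreal (rearr x) * indicator B x \<partial>lborel) + c * indicator B 0"
proof (rule emeasure_measure_of[OF symmetrization_eq])
  let ?\<mu> = "\<lambda>B. (\<integral>\<^sup>+x. ennreal (rearr x) * indicator B x \<partial>lborel) + c * indicator B 0"
  show "positive (sets (symmetrization f c)) ?\<mu>"
    by (simp add: positive_def)
  show "countably_additive (sets (symmetrization f c)) ?\<mu>"
    unfolding sets_symmetrization
  proof (rule countably_additiveI)
    fix F :: "nat \<Rightarrow> real set"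
    assume F: "range F \<subseteq> sets borel" "disjoint_family F" "(\<Union>i. F i) \<in> sets borel"
    have dens: "(\<integral>\<^sup>+x. ennreal (rearr x) * indicator B x \<partial>lborel) = emeasure (density lborel rearr) B" if "B \<in> sets borel" for B
      using that by (simp add: emeasure_density)
    have "(\<Sum>i. ?\<mu> (F i)) = (\<Sum>i. emeasure (density lborel rearr) (F i)) + (\<Sum>i. c * indicator (F i) 0)"
      using F(1) by (subst suminf_add[symmetric]) (auto simp: dens subset_eq)
    also have "(\<Sum>i. emeasure (density lborel rearr) (F i)) = emeasure (density lborel rearr) (\<Union>i. F i)"
      using F by (intro suminf_emeasure) auto
    also have "(\<Sum>i. c * indicator (F i) 0) = c * indicator (\<Union>i. F i) (0::real)"
      using F(2) by (simp add: suminf_indicator)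
    finally show "(\<Sum>i. ?\<mu> (F i)) = ?\<mu> (\<Union>i. F i)"
      using F(3) by (simp add: dens)
  qed
qed (use assms in \<open>auto simp: sets_symmetrization\<close>)

lemma symmetrization_even: "distr (symmetrization f c) borel uminus = symmetrization f c"
proof (rule measure_eqI)
  fix B assume "B \<in> sets (distr (symmetrization f c) borel uminus)"
  then have [measurable]: "B \<in> sets borel" by simp
  have sp: "space (symmetrization f c) = UNIV"
    using sets_eq_imp_space_eq[OF sets_symmetrization] by simp
  have uminus: "uminus \<in> measurable (symmetrization f c) borel"
    unfolding measurable_cong_sets[OF sets_symmetrization refl] by measurable
  have pre: "uminus -` B \<in> sets borel"
    using measurable_sets[of uminus borel borel B] by simp
  have "(\<integral>\<^sup>+x. ennreal (rearr x) * indicator B x \<partial>lborel) = (\<integral>\<^sup>+x. ennreal (rearr (-x)) * indicator B (-x) \<partial>lborel)"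
    using nn_integral_real_affine[of "\<lambda>x. ennreal (rearr x) * indicator B x" "-1" 0] by simp
  also have "\<dots> = (\<integral>\<^sup>+x. ennreal (rearr x) * indicator (uminus -` B) x \<partial>lborel)"
    by (simp add: rearr_even indicator_vimage[symmetric] indicator_def)
  finally show "emeasure (distr (symmetrization f c) borel uminus) B = emeasure (symmetrization f c) B"
    using pre by (simp add: emeasure_distr[OF uminus] sp emeasure_symmetrization indicator_def)
qed (simp add: sets_symmetrization)

end

section \<open>Domination by the symmetrization, and rigidity from equal norms\<close>

theorem theorem6p1:
  fixes M S :: "real measure" and f :: "real \<Rightarrow> real"
  assumes sets_M: "sets M = sets borel"
    and finite_M: "finite_measure M"
    and supp_M: "emeasure M (UNIV - {-pi<..<pi}) = 0"
    and nonzero_M: "emeasure M UNIV \<noteq> 0"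
    and f_meas: "f \<in> borel_measurable borel"
    and f_nonneg: "\<And>x. 0 \<le> f x"
    and sets_S: "sets S = sets borel"
    and S_singular: "\<exists>N \<in> null_sets lborel. emeasure S (UNIV - N) = 0"
    and decomp: "\<And>A. A \<in> sets borel \<Longrightarrow>
        emeasure M A = (\<integral>\<^sup>+x. ennreal (f x) * indicator A x \<partial>lborel) + emeasure S A"
  shows "\<forall>p::ereal. 1 \<le> p \<longrightarrow>
           Lp_norm p (u_meas M) \<le> Lp_norm p (u_meas (symmetrization f (emeasure S UNIV)))
           \<and> (Lp_norm p (u_meas M) = Lp_norm p (u_meas (symmetrization f (emeasure S UNIV)))
            \<longleftrightarrow> ((AE x in lborel. x \<in> {-pi<..<pi} \<longrightarrow> f x = symm_rearr f x)
                 \<and> emeasure S (UNIV - {0}) = 0))"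
proof -
  note [measurable] = f_meas
  interpret nonneg_function f
    using f_meas f_nonneg by unfold_locales
  interpret M: finite_measure_on_interval M
    using finite_M sets_M supp_M
    by (simp add: finite_measure_on_interval_def finite_measure_on_interval_axioms_def)
  define c where "c = emeasure S UNIV"
  define N where "N = symmetrization f c"
  let ?I = "\<lambda>B. \<integral>\<^sup>+x. ennreal (f x) * indicator B x \<partial>lborel"
  have M_fin: "emeasure M B \<noteq> \<infinity>" for B
    by (simp add: M.emeasure_eq_measure)
  have I_fin: "?I B \<noteq> \<infinity>" if "B \<in> sets borel" for B
    using M_fin[of B] decomp[OF that] by auto
  have c_fin: "c \<noteq> \<infinity>"
    using M_fin[of UNIV] decomp[of UNIV] by (auto simp: c_def)
  have S_le: "emeasure S B \<le> c" for B
    unfolding c_def using emeasure_space[of S B] sets_eq_imp_space_eq[OF sets_S] by simp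
  have emeasure_N: "emeasure N B = (\<integral>\<^sup>+x. ennreal (rearr x) * indicator B x \<partial>lborel) + c * indicator B 0"
    if "B \<in> sets borel" for B
    unfolding N_def using that by (rule emeasure_symmetrization)
  have sets_N: "sets N = sets borel"
    by (simp add: N_def sets_symmetrization)
  have space_N: "space N = UNIV"
    using sets_eq_imp_space_eq[OF sets_N] by simp
  have N_fin: "finite_measure N"
    using emeasure_N[of UNIV] c_fin I_fin[of "{-pi<..<pi}"]
    by (intro finite_measureI) (simp add: space_N nn_integral_rearr_eq)
  interpret N: finite_measure_on_interval N
  proof (intro finite_measure_on_interval.intro finite_measure_on_interval_axioms.intro N_fin sets_N)
    have "(\<integral>\<^sup>+x. ennreal (rearr x) * indicator (UNIV - {-pi<..<pi}) x \<partial>lborel) = (\<integral>\<^sup>+x. 0 \<partial>(lborel :: real measure))"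
      by (intro nn_integral_cong) (auto simp: rearr_def split: split_indicator)
    then show "emeasure N (UNIV - {-pi<..<pi}) = 0"
      by (simp add: emeasure_N)
  qed
  \<comment> \<open>The density part is controlled by rearrangement on an interval of length
    \<open>b - a\<close>. The singular part is controlled by its total mass, which \<open>N\<close>
    places at the origin, inside every nonempty centred interval.\<close>
  interpret radial_domination M N
  proof
    show "distr N borel uminus = N"
      unfolding N_def by (rule symmetrization_even)
    fix a b :: real assume ab: "-pi \<le> a" "a < b" "b \<le> pi"
    have "?I {a<..<b} \<le> (\<integral>\<^sup>+x. ennreal (rearr x) * indicator {- ((b - a) / 2)<..<(b - a) / 2} x \<partial>lborel)"
      using ab by (intro nn_integral_le_rearrangement) auto
    then show "emeasure M {a<..<b} \<le> emeasure N {- ((b - a) / 2)<..<(b - a) / 2}"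
      using ab S_le[of "{a<..<b}"] by (simp add: decomp emeasure_N add_mono)
  qed
  have AE_rearr: "(AE x in lborel. x \<in> {-pi<..<pi} \<longrightarrow> f x = symm_rearr f x)
      \<longleftrightarrow> (AE x in lborel. x \<in> {-pi<..<pi} \<longrightarrow> f x = rearr x)"
    by (intro eventually_subst eventually_mono[OF AE_lborel_singleton[of 0]]) (auto simp: rearr_def abs_less_iff)
  \<comment> \<open>Shrinking centred intervals to the origin isolates the singular part;
    subtracting it from the equal masses leaves the densities.\<close>
  have rigid: "(AE x in lborel. x \<in> {-pi<..<pi} \<longrightarrow> f x = rearr x) \<and> emeasure S (UNIV - {0}) = 0"
    if p: "1 \<le> p" and eq: "Lp_norm p (u_meas M) = Lp_norm p (u_meas N)" for p
  proof -
    note cen = Lp_norm_eq_imp_emeasure_centered_eq[OF nonzero_M p eq]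
    define J where "J n = {- (1 / Suc n)<..<1 / real (Suc n)}" for n
    have J_sets: "range J \<subseteq> sets borel"
      by (auto simp: J_def)
    have J_dec: "decseq J"
    proof (rule decseq_SucI)
      fix n
      have "1 / real (Suc (Suc n)) \<le> 1 / Suc n" by (simp add: field_simps)
      then show "J (Suc n) \<subseteq> J n" by (auto simp: J_def simp del: of_nat_Suc)
    qed
    have J_Int: "(\<Inter>n. J n) = {0}"
    proof safe
      fix x assume x: "x \<in> (\<Inter>n. J n)"
      show "x = 0"
      proof (rule ccontr)
        assume "x \<noteq> 0"
        then obtain n where "1 / Suc n < \<bar>x\<bar>" using nat_approx_posE[of "\<bar>x\<bar>"] by auto
        moreover have "x \<in> J n" using x by blast
        ultimately show False by (auto simp: J_def simp del: of_nat_Suc)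
      qed
    qed (auto simp: J_def)
    have "emeasure M (J n) = emeasure N (J n)" for n
    proof -
      have "1 / real (Suc n) \<le> 1" by simp
      also have "1 \<le> pi" using pi_gt3 by simp
      finally show ?thesis unfolding J_def by (intro cen) auto
    qed
    moreover have "(\<lambda>n. emeasure M (J n)) \<longlonglongrightarrow> emeasure M {0}"
      unfolding J_Int[symmetric] using J_sets J_dec M_fin by (intro Lim_emeasure_decseq) (simp_all add: sets_M)
    moreover have "(\<lambda>n. emeasure N (J n)) \<longlonglongrightarrow> emeasure N {0}"
      unfolding J_Int[symmetric] using J_sets J_dec
      by (intro Lim_emeasure_decseq) (simp_all add: sets_N N.emeasure_eq_measure)
    ultimately have M0: "emeasure M {0} = emeasure N {0}"
      using LIMSEQ_unique by fastforce
    have zero: "(\<integral>\<^sup>+x. h x * indicator {0} x \<partial>lborel) = 0" for h :: "real \<Rightarrow> ennreal"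
    proof -
      have "(\<integral>\<^sup>+x. h x * indicator {0} x \<partial>lborel) = (\<integral>\<^sup>+x. 0 \<partial>(lborel::real measure))"
        using AE_lborel_singleton[of 0] by (intro nn_integral_cong_AE) (auto elim!: eventually_mono)
      then show ?thesis by simp
    qed
    \<comment> \<open>Densities give no mass to a point, so the equal masses at the origin are those
      of \<open>S\<close> and of the Dirac part.\<close>
    have S0: "emeasure S {0} = c"
      using M0 by (simp add: decomp emeasure_N zero)
    have "emeasure S {0} + emeasure S (UNIV - {0}) = c"
      unfolding c_def by (subst plus_emeasure) (auto simp: sets_S)
    then have S_null: "emeasure S (UNIV - {0}) = 0"
      using c_fin S0 by (metis add.right_neutral ennreal_add_left_cancel infinity_ennreal_def)
    \<comment> \<open>All of \<open>S\<close> now sits inside the interval, so the finite mass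
      \<open>c\<close> cancels on both sides.\<close>
    have "?I {-r<..<r} = (\<integral>\<^sup>+x. ennreal (rearr x) * indicator {-r<..<r} x \<partial>lborel)" if r: "0 < r" "r \<le> pi" for r
    proof -
      have "c \<le> emeasure S {-r<..<r}"
        unfolding S0[symmetric] using r by (intro emeasure_mono) (auto simp: sets_S)
      then have "emeasure S {-r<..<r} = c"
        using S_le by (intro antisym)
      then have "c + ?I {-r<..<r} = c + (\<integral>\<^sup>+x. ennreal (rearr x) * indicator {-r<..<r} x \<partial>lborel)"
        using cen[OF r] r by (simp add: decomp emeasure_N add.commute)
      then show ?thesis
        using c_fin by (subst (asm) ennreal_add_left_cancel) auto
    qed
    then have "AE x in lborel. x \<in> {-pi<..<pi} \<longrightarrow> f x = rearr x"
      using I_fin[of "{-pi<..<pi}"] by (intro AE_eq_rearrangement) auto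
    with S_null show ?thesis by blast
  qed
  have M_eq_N: "M = N"
    if f: "AE x in lborel. x \<in> {-pi<..<pi} \<longrightarrow> f x = rearr x" and S: "emeasure S (UNIV - {0}) = 0"
  proof (rule measure_eqI)
    fix B assume "B \<in> sets M"
    then have B[measurable]: "B \<in> sets borel" by (simp add: sets_M)
    \<comment> \<open>Since \<open>M\<close> has no mass off the interval, \<open>f\<close> vanishes
      there almost everywhere, as does \<open>rearr\<close>; the densities thus agree on the whole
      line.\<close>
    have "?I (UNIV - {-pi<..<pi}) = 0"
      using supp_M decomp[of "UNIV - {-pi<..<pi}"] by simp
    then have "AE x in lborel. ennreal (f x) * indicator (UNIV - {-pi<..<pi}) x = 0"
      by (subst (asm) nn_integral_0_iff_AE) auto
    with f have "AE x in lborel. f x = rearr x"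
    proof eventually_elim
      case (elim x)
      then show ?case using f_nonneg[of x] by (cases "x \<in> {-pi<..<pi}") (auto simp: rearr_def)
    qed
    then have "?I B = (\<integral>\<^sup>+x. ennreal (rearr x) * indicator B x \<partial>lborel)"
      by (intro nn_integral_cong_AE) (auto elim!: eventually_mono)
    moreover have "emeasure S B = c * indicator B 0"
    proof -
      have null: "emeasure S D = 0" if "D \<subseteq> UNIV - {0}" for D
        using emeasure_mono[OF that, of S] S by (simp add: sets_S)
      have split: "emeasure S D = emeasure S (D \<inter> {0})" if "D \<in> sets borel" for D
        using plus_emeasure[of "D \<inter> {0}" S "D - {0}"] that null[OF Diff_mono[OF subset_UNIV order_refl], of D]
        by (simp add: sets_S Int_Diff_Un Int_Diff_disjoint)
      have "emeasure S {0} = c"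
        using split[of UNIV] by (simp add: c_def)
      then show ?thesis
        using split[OF B] by (cases "0 \<in> B") auto
    qed
    ultimately show "emeasure M B = emeasure N B"
      by (simp add: decomp emeasure_N)
  qed (simp add: sets_M sets_N)
  show ?thesis
    unfolding c_def[symmetric] N_def[symmetric] AE_rearr
    using Lp_norm_le(1) rigid M_eq_N by blast
qed

end
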